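(* Let $f:\mathbb{R}^n\to\mathbb{R}$, $h:\mathbb{R}^n\to\mathbb{R}^{p_1}$, $g:\mathbb{R}^n\to\mathbb{R}^{p_2}$ be twice continuously differentiable, and let $x^*$ be a local minimizer of the problem of minimizing $f(x)$ subject to $h(x)=0$, $g(x)\leq 0$, such that $x^*$ satisfies the Mangasarian-Fromovitz constraint qualification. Let $(\lambda^1,\mu^1),\dots,(\lambda^v,\mu^v)$ be the vertices of the Lagrange multiplier set $\Lambda(x^* )$. If the rank of the set of matrices $\{\nabla^2 L(x^*,\lambda^i,\mu^i)\}_{i=1}^v$ is at most $2$, then for every first-order cone $K\subseteq C(x^* )$ there exists $(\lambda,\mu)\in\Lambda(x^* )$ such that $$d^{T}\nabla^2L(x^*,\lambda,\mu)d\geq 0\quad\text{for all } d\in K.$$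
   Context: For a feasible point $x$, $A(x)=\{i\in\{1,\dots,p_2\}\mid g_i(x)=0\}$ is the index set of active inequality constraints. For $(\lambda,\mu)\in\mathbb{R}^{p_1}\times\mathbb{R}^{p_2}_+$ (where $\mathbb{R}^{p_2}_+$ is the non-negative orthant), the Lagrangian is $L(x,\lambda,\mu)=f(x)+\sum_{i=1}^{p_1}\lambda_ih_i(x)+\sum_{i=1}^{p_2}\mu_ig_i(x)$; $\nabla L$ and $\nabla^2 L$ denote its gradient and Hessian with respect to $x$. A feasible point $x^*$ satisfies the Mangasarian-Fromovitz constraint qualification when $(\alpha,\beta)=(0,0)$ is the only solution of $\sum_{i=1}^{p_1}\alpha_i\nabla h_i(x^* )+\sum_{i\in A(x^* )}\beta_i\nabla g_i(x^* )=0$ with $\alpha_i\in\mathbb{R}$ for $i=1,\dots,p_1$ and $\beta_i\geq 0$ for $i\in A(x^* )$. The Lagrange multiplier set is $\Lambda(x^* )=\{(\lambda,\mu)\in\mathbb{R}^{p_1}\times\mathbb{R}^{p_2}_+\mid \nabla L(x^*,\lambda,\mu)=0,\ \mu^{T} g(x^* )=0\}$, which is a closed polyhedron; at a local minimizer satisfying the Mangasarian-Fromovitz constraint qualification it is nonempty and bounded. Its vertices are its extreme points. The critical cone is $C(x^* )=\{d\in\mathbb{R}^n \mid \nabla h_i(x^* )^{T} d=0,\ i=1,\dots,p_1;\ \nabla g_i(x^* )^{T} d\leq 0,\ i\in A(x^* );\ \nabla f(x^* )^{T} d=0\}$. A set $K\subseteq\mathbb{R}^n$ is a first-order cone if it is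 the direct sum of a subspace and a ray, i.e. $K=\{s+t d_0 \mid s\in S,\ t\ge 0\}$ for some linear subspace $S\subseteq\mathbb{R}^n$ and some $d_0\in\mathbb{R}^n$. The rank of a set of matrices is the maximum number of linearly independent matrices in the set, viewed as vectors in the matrix space. *)

theory Defs
  imports "HOL-Analysis.Analysis"
begin

text \<open>
  The problem is to minimize \<open>f x\<close> subject to \<open>h i x = 0\<close> for \<open>i \<in> E\<close> and \<open>g j x \<le> 0\<close> for \<open>j \<in> I\<close>.
  The constraints are indexed by arbitrary subsets \<open>E\<close>, \<open>I\<close> of finite types rather than by whole types,
  since types are nonempty and problems without equality (or inequality) constraints must be covered.
  Thus \<open>p\<^sub>1 = card E\<close> and \<open>p\<^sub>2 = card I\<close>. Multipliers are vectors over the full index types; their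
  entries outside \<open>E\<close> and \<open>I\<close> are required to vanish, which identifies the set of
  multipliers with a subset of the product of the spaces of dimensions \<open>p\<^sub>1\<close> and \<open>p\<^sub>2\<close>.
\<close>

definition gradient :: "(real ^ 'n \<Rightarrow> real) \<Rightarrow> real ^ 'n \<Rightarrow> real ^ 'n" where
  "gradient f x = (THE D. GDERIV f x :> D)"

lemma gradient_eqI:
  assumes "GDERIV f x :> D"
  shows "gradient f x = D"
  unfolding gradient_def
proof (rule the_equality)
  fix D' assume "GDERIV f x :> D'"
  with assms have "(\<lambda>h. h \<bullet> D') = (\<lambda>h. h \<bullet> D)"
    unfolding gderiv_def by (metis has_derivative_unique)
  then show "D' = D"
    by (metis vector_eq_rdot inner_commute)
qed (fact assms)

lemma gradient_works:
  assumes "f differentiable at x"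
  shows "GDERIV f x :> gradient f x"
proof -
  obtain f' where f': "(f has_derivative f') (at x)"
    using assms unfolding differentiable_def by blast
  then have lin: "linear f'" by (rule has_derivative_linear)
  have "f' = (\<lambda>h. h \<bullet> adjoint f' 1)"
    using adjoint_works[OF lin] by (auto simp: fun_eq_iff)
  with f' have "GDERIV f x :> adjoint f' 1" unfolding gderiv_def by simp
  then show ?thesis using gradient_eqI by metis
qed

definition hessian :: "(real ^ 'n \<Rightarrow> real) \<Rightarrow> real ^ 'n \<Rightarrow> real ^ 'n ^ 'n" where
  "hessian f x = jacobian (gradient f) (at x)"

definition twice_continuously_differentiable :: "(real ^ 'n \<Rightarrow> real) \<Rightarrow> bool" where
  "twice_continuously_differentiable f \<longleftrightarrow>
     (\<forall>x. f differentiable at x) \<and>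
     (\<forall>x. gradient f differentiable at x) \<and>
     continuous_on UNIV (hessian f)"

definition feasible ::
  "'p::finite set \<Rightarrow> ('p \<Rightarrow> real ^ 'n \<Rightarrow> real) \<Rightarrow> 'q::finite set \<Rightarrow> ('q \<Rightarrow> real ^ 'n \<Rightarrow> real) \<Rightarrow> real ^ 'n \<Rightarrow> bool" where
  "feasible E h I g x \<longleftrightarrow> (\<forall>i\<in>E. h i x = 0) \<and> (\<forall>j\<in>I. g j x \<le> 0)"

definition local_minimizer ::
  "(real ^ 'n \<Rightarrow> real) \<Rightarrow> 'p::finite set \<Rightarrow> ('p \<Rightarrow> real ^ 'n \<Rightarrow> real) \<Rightarrow>
   'q::finite set \<Rightarrow> ('q \<Rightarrow> real ^ 'n \<Rightarrow> real) \<Rightarrow> real ^ 'n \<Rightarrow> bool" where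
  "local_minimizer f E h I g x \<longleftrightarrow>
     feasible E h I g x \<and>
     (\<exists>\<epsilon>>0. \<forall>y\<in>ball x \<epsilon>. feasible E h I g y \<longrightarrow> f x \<le> f y)"

definition active_set :: "'q::finite set \<Rightarrow> ('q \<Rightarrow> real ^ 'n \<Rightarrow> real) \<Rightarrow> real ^ 'n \<Rightarrow> 'q set" where
  "active_set I g x = {j \<in> I. g j x = 0}"

definition MFCQ ::
  "'p::finite set \<Rightarrow> ('p \<Rightarrow> real ^ 'n \<Rightarrow> real) \<Rightarrow> 'q::finite set \<Rightarrow> ('q \<Rightarrow> real ^ 'n \<Rightarrow> real) \<Rightarrow> real ^ 'n \<Rightarrow> bool" where
  "MFCQ E h I g x \<longleftrightarrow>
     feasible E h I g x \<and>
     (\<forall>\<alpha> \<beta>.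
        (\<Sum>i\<in>E. \<alpha> i *\<^sub>R gradient (h i) x) + (\<Sum>j\<in>active_set I g x. \<beta> j *\<^sub>R gradient (g j) x) = 0 \<and>
        (\<forall>j\<in>active_set I g x. \<beta> j \<ge> 0) \<longrightarrow>
        (\<forall>i\<in>E. \<alpha> i = 0) \<and> (\<forall>j\<in>active_set I g x. \<beta> j = 0))"

definition lagrangian ::
  "(real ^ 'n \<Rightarrow> real) \<Rightarrow> 'p::finite set \<Rightarrow> ('p \<Rightarrow> real ^ 'n \<Rightarrow> real) \<Rightarrow> 'q::finite set \<Rightarrow> ('q \<Rightarrow> real ^ 'n \<Rightarrow> real) \<Rightarrow>
   real ^ 'p \<Rightarrow> real ^ 'q \<Rightarrow> real ^ 'n \<Rightarrow> real" where
  "lagrangian f E h I g lam mu x = f x + (\<Sum>i\<in>E. lam $ i * h i x) + (\<Sum>j\<in>I. mu $ j * g j x)"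

definition multiplier_set ::
  "(real ^ 'n \<Rightarrow> real) \<Rightarrow> 'p::finite set \<Rightarrow> ('p \<Rightarrow> real ^ 'n \<Rightarrow> real) \<Rightarrow> 'q::finite set \<Rightarrow> ('q \<Rightarrow> real ^ 'n \<Rightarrow> real) \<Rightarrow>
   real ^ 'n \<Rightarrow> ((real ^ 'p) \<times> (real ^ 'q)) set" where
  "multiplier_set f E h I g x =
     {(lam, mu).
        (\<forall>i. i \<notin> E \<longrightarrow> lam $ i = 0) \<and> (\<forall>j. j \<notin> I \<longrightarrow> mu $ j = 0) \<and>
        (\<forall>j\<in>I. mu $ j \<ge> 0) \<and>
        gradient (lagrangian f E h I g lam mu) x = 0 \<and>
        (\<Sum>j\<in>I. mu $ j * g j x) = 0}"

definition critical_cone ::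
  "(real ^ 'n \<Rightarrow> real) \<Rightarrow> 'p::finite set \<Rightarrow> ('p \<Rightarrow> real ^ 'n \<Rightarrow> real) \<Rightarrow> 'q::finite set \<Rightarrow> ('q \<Rightarrow> real ^ 'n \<Rightarrow> real) \<Rightarrow>
   real ^ 'n \<Rightarrow> (real ^ 'n) set" where
  "critical_cone f E h I g x =
     {d. (\<forall>i\<in>E. gradient (h i) x \<bullet> d = 0) \<and>
         (\<forall>j\<in>active_set I g x. gradient (g j) x \<bullet> d \<le> 0) \<and>
         gradient f x \<bullet> d = 0}"

definition first_order_cone :: "(real ^ 'n) set \<Rightarrow> bool" where
  "first_order_cone K \<longleftrightarrow>
     (\<exists>S d0. subspace S \<and> K = {s + t *\<^sub>R d0 | s t. s \<in> S \<and> t \<ge> 0})"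

definition matrix_set_rank :: "(real ^ 'n ^ 'm) set \<Rightarrow> nat" where
  "matrix_set_rank M = Max {card B | B. B \<subseteq> M \<and> independent B}"

text \<open>The maximum above is over a finite nonempty set, even for infinite \<open>M\<close>.\<close>

lemma matrix_set_rank_eq_dim: "matrix_set_rank M = dim M"
proof -
  obtain B where B: "B \<subseteq> M" "independent B" "card B = dim M"
    using basis_exists by metis
  have le: "card C \<le> dim M" if "C \<subseteq> M" "independent C" for C
    using that by (metis dim_eq_card_independent dim_subset)
  show ?thesis
    unfolding matrix_set_rank_def
  proof (rule Max_eqI)
    show "finite {card B | B. B \<subseteq> M \<and> independent B}"
      by (rule finite_subset[of _ "{..dim M}"]) (use le in auto)
    show "dim M \<in> {card B | B. B \<subseteq> M \<and> independent B}"
      using B by (smt (verit) mem_Collect_eq)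
  qed (use le in auto)
qed

end

theory Submission
  imports Defs
begin

text \<open>
  For a critical direction \<open>d\<close>, suppose that some \<open>w\<close> solves the second-order system at \<open>d\<close>
  strictly for the objective and the active inequalities and exactly for the equalities.
  Brouwer's theorem corrects the parabola \<open>xs + t d + (t\<^sup>2 / 2) w\<close> to feasible points
  with a smaller objective, which contradicts minimality. Separation then yields a multiplier with
  nonnegative curvature along \<open>d\<close>; it depends on \<open>d\<close>.
  To choose one multiplier for all \<open>d\<close> in a first-order cone \<open>K\<close>, note that \<open>K \<union> - K\<close>
  is a subspace \<open>V\<close>, and that all Hessians of the Lagrangian are combinations of two matrices \<open>P\<close>, \<open>Q\<close>,
  since the multiplier set is the convex hull of its vertices. By Dines' theorem the image
  of \<open>V\<close> under \<open>d \<mapsto> (d\<^sup>T P d, d\<^sup>T Q d)\<close> is a convex cone in the plane, so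
  a minimax argument exchanges the quantifiers.
\<close>

subsection \<open>Second-order expansions along parabolas\<close>

text \<open>Subtracting the quadratic Taylor polynomial along the segment leaves a function of one
  variable whose derivative is the inner product of \<open>z\<close> with the first-order remainder
  of the gradient. The mean value theorem turns the \<open>e * norm z\<close> bound on that
  remainder into a quadratic one.\<close>

lemma taylor_second_order:
  assumes F: "twice_continuously_differentiable F" and "e > 0"
  shows "\<exists>\<delta>>0. \<forall>z. norm z < \<delta> \<longrightarrow>
    \<bar>F (x + z) - F x - gradient F x \<bullet> z - (z \<bullet> (hessian F x *v z)) / 2\<bar> \<le> e * (norm z)\<^sup>2"
proof -
  have "(gradient F has_derivative (\<lambda>z. hessian F x *v z)) (at x)"
    using F unfolding twice_continuously_differentiable_def hessian_def
    by (metis jacobian_works)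
  then obtain \<delta> where "\<delta> > 0" and
    \<delta>: "\<And>z. norm z < \<delta> \<Longrightarrow>
      norm (gradient F (x + z) - gradient F x - hessian F x *v z) \<le> e * norm z"
    using \<open>e > 0\<close> unfolding has_derivative_at_alt by (metis add_diff_cancel_left')
  have "\<bar>F (x + z) - F x - gradient F x \<bullet> z - (z \<bullet> (hessian F x *v z)) / 2\<bar> \<le> e * (norm z)\<^sup>2"
    if z: "norm z < \<delta>" for z
  proof -
    define \<phi> where "\<phi> s = F (x + s *\<^sub>R z) - s * (gradient F x \<bullet> z)
        - s\<^sup>2 * (z \<bullet> (hessian F x *v z)) / 2" for s
    have dF: "((\<lambda>s. F (x + s *\<^sub>R z)) has_real_derivative (z \<bullet> gradient F (x + s *\<^sub>R z))) (at s)" for s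
    proof -
      have "(F has_derivative (\<lambda>h. h \<bullet> gradient F (x + s *\<^sub>R z))) (at (x + s *\<^sub>R z))"
        using gradient_works F unfolding twice_continuously_differentiable_def gderiv_def by blast
      moreover have "((\<lambda>s. x + s *\<^sub>R z) has_derivative (\<lambda>h. h *\<^sub>R z)) (at s)"
        by (auto intro!: derivative_eq_intros)
      ultimately have "((\<lambda>s. F (x + s *\<^sub>R z)) has_derivative
          (\<lambda>h. (h *\<^sub>R z) \<bullet> gradient F (x + s *\<^sub>R z))) (at s)"
        using diff_chain_at[unfolded o_def] by fast
      then show ?thesis
        unfolding has_field_derivative_def by (simp add: mult_commute_abs)
    qed
    have d\<phi>: "(\<phi> has_real_derivative (z \<bullet> gradient F (x + s *\<^sub>R z) - gradient F x \<bullet> z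
        - s * (z \<bullet> (hessian F x *v z)))) (at s)" for s
      unfolding \<phi>_def by (auto intro!: derivative_eq_intros dF)
    obtain s where s: "0 < s" "s < 1" and "\<phi> 1 - \<phi> 0 = (1 - 0) * (z \<bullet> gradient F (x + s *\<^sub>R z)
        - gradient F x \<bullet> z - s * (z \<bullet> (hessian F x *v z)))"
      using MVT2[OF zero_less_one, of \<phi>, OF d\<phi>] by blast
    then have eq: "\<phi> 1 - \<phi> 0 = z \<bullet> (gradient F (x + s *\<^sub>R z) - gradient F x - hessian F x *v (s *\<^sub>R z))"
      by (simp add: inner_diff_right matrix_vector_mult_scaleR inner_commute)
    have sz: "norm (s *\<^sub>R z) \<le> norm z"
      using s by (simp add: mult_left_le_one_le)
    have "\<bar>\<phi> 1 - \<phi> 0\<bar> \<le> norm z * norm (gradient F (x + s *\<^sub>R z) - gradient F x - hessian F x *v (s *\<^sub>R z))"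
      unfolding eq by (rule Cauchy_Schwarz_ineq2)
    also have "\<dots> \<le> norm z * (e * norm (s *\<^sub>R z))"
      using \<delta>[of "s *\<^sub>R z"] sz z by (intro mult_left_mono) auto
    also have "\<dots> \<le> norm z * (e * norm z)"
      using sz \<open>e > 0\<close> by (intro mult_left_mono) auto
    finally show ?thesis
      by (simp add: \<phi>_def power2_eq_square algebra_simps)
  qed
  then show ?thesis using \<open>\<delta> > 0\<close> by blast
qed

text \<open>With \<open>v = d + (t / 2) *\<^sub>R u\<close> the displacement is exactly
  \<open>t *\<^sub>R v\<close>. For \<open>u\<close> in a bounded set, \<open>v\<close> tends to
  \<open>d\<close> uniformly, so the quadratic form at \<open>v\<close> may be replaced by the one
  at \<open>d\<close>; this and the Taylor error each take half of
  \<open>e * t\<^sup>2\<close>.\<close>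

lemma second_order_expansion:
  assumes F: "twice_continuously_differentiable F" and U: "bounded U" and "e > 0"
  shows "\<forall>\<^sub>F t in at_right 0. \<forall>u\<in>U.
    \<bar>F (x + t *\<^sub>R d + (t\<^sup>2 / 2) *\<^sub>R u)
      - (F x + t * (gradient F x \<bullet> d) + t\<^sup>2 / 2 * (gradient F x \<bullet> u + d \<bullet> (hessian F x *v d)))\<bar> \<le> e * t\<^sup>2"
proof -
  let ?q = "\<lambda>v. v \<bullet> (hessian F x *v v)"
  obtain B where "B > 0" and B: "\<And>u. u \<in> U \<Longrightarrow> norm u \<le> B"
    using U bounded_pos by blast
  have "isCont ?q d"
    by (intro continuous_intros linear_continuous_at) (simp add: matrix_vector_mul_bounded_linear)
  then obtain \<eta> where "\<eta> > 0" and \<eta>: "\<And>v. norm (v - d) < \<eta> \<Longrightarrow> \<bar>?q v - ?q d\<bar> < e"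
    using \<open>e > 0\<close> unfolding continuous_at_eps_delta dist_norm real_norm_def by blast
  \<comment> \<open>\<open>N\<close> will bound \<open>norm v\<close>, and the tolerance
    \<open>e / (2 * N\<^sup>2)\<close> then makes the Taylor error at most
    \<open>e * t\<^sup>2 / 2\<close>.\<close>
  define N where "N = norm d + 1"
  have "N > 0" unfolding N_def by (simp add: add_nonneg_pos)
  obtain \<delta> where "\<delta> > 0" and \<delta>: "\<And>z. norm z < \<delta> \<Longrightarrow>
      \<bar>F (x + z) - F x - gradient F x \<bullet> z - ?q z / 2\<bar> \<le> e / (2 * N\<^sup>2) * (norm z)\<^sup>2"
    using taylor_second_order[OF F, of "e / (2 * N\<^sup>2)" x] \<open>e > 0\<close> \<open>N > 0\<close> by auto
  \<comment> \<open>The three bounds on \<open>t\<close> ensure \<open>norm v \<le> N\<close>,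
    closeness of \<open>?q v\<close> to \<open>?q d\<close>, and that \<open>t *\<^sub>R v\<close>
    is short enough for the Taylor estimate.\<close>
  define \<tau> where "\<tau> = min (min (1 / B) (\<eta> / B)) (\<delta> / N)"
  have "\<tau> > 0" using \<open>B > 0\<close> \<open>\<eta> > 0\<close> \<open>\<delta> > 0\<close> \<open>N > 0\<close> by (simp add: \<tau>_def)
  have "\<bar>F (x + t *\<^sub>R d + (t\<^sup>2 / 2) *\<^sub>R u)
      - (F x + t * (gradient F x \<bullet> d) + t\<^sup>2 / 2 * (gradient F x \<bullet> u + ?q d))\<bar> \<le> e * t\<^sup>2"
    if t: "0 < t" "t < \<tau>" and u: "u \<in> U" for t u
  proof -
    define v where "v = d + (t / 2) *\<^sub>R u"
    have tB: "t * B < 1" "t * B < \<eta>" and tN: "t * N < \<delta>"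
      using t \<open>B > 0\<close> \<open>N > 0\<close> by (auto simp: \<tau>_def field_simps)
    have "norm (v - d) \<le> t / 2 * B"
      using t B[OF u] by (simp add: v_def)
    also have "\<dots> \<le> t * B" using t \<open>B > 0\<close> by simp
    finally have vd: "norm (v - d) \<le> t * B" .
    then have q: "\<bar>?q v - ?q d\<bar> < e" using \<eta> tB by auto
    have "norm v \<le> norm d + norm (v - d)" by (metis diff_add_cancel norm_triangle_ineq add.commute)
    then have vN: "norm v \<le> N" using vd tB by (simp add: N_def)
    have "norm (t *\<^sub>R v) \<le> t * N" using vN t by simp
    have "\<bar>F (x + t *\<^sub>R v) - F x - gradient F x \<bullet> (t *\<^sub>R v) - ?q (t *\<^sub>R v) / 2\<bar>
        \<le> e / (2 * N\<^sup>2) * (norm (t *\<^sub>R v))\<^sup>2"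
      by (rule \<delta>[OF le_less_trans[OF \<open>norm (t *\<^sub>R v) \<le> t * N\<close> tN]])
    also have "\<dots> \<le> e / (2 * N\<^sup>2) * (t * N)\<^sup>2"
      using \<open>norm (t *\<^sub>R v) \<le> t * N\<close> \<open>e > 0\<close> by (intro mult_left_mono power_mono) auto
    also have "\<dots> = e * t\<^sup>2 / 2" using \<open>N > 0\<close> by (simp add: field_simps power2_eq_square)
    finally have 1: "\<bar>F (x + t *\<^sub>R v) - F x - gradient F x \<bullet> (t *\<^sub>R v) - t\<^sup>2 * ?q v / 2\<bar> \<le> e * t\<^sup>2 / 2"
      by (simp add: matrix_vector_mult_scaleR power2_eq_square mult.assoc)
    have "\<bar>t\<^sup>2 * ?q v / 2 - t\<^sup>2 * ?q d / 2\<bar> = t\<^sup>2 / 2 * \<bar>?q v - ?q d\<bar>"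
      by (simp add: abs_mult flip: right_diff_distrib diff_divide_distrib)
    also have "\<dots> \<le> t\<^sup>2 / 2 * e" using q by (intro mult_left_mono) auto
    finally have 2: "\<bar>t\<^sup>2 * ?q v / 2 - t\<^sup>2 * ?q d / 2\<bar> \<le> e * t\<^sup>2 / 2" by (simp add: mult.commute)
    have 3: "x + t *\<^sub>R d + (t\<^sup>2 / 2) *\<^sub>R u = x + t *\<^sub>R v"
      by (simp add: v_def algebra_simps power2_eq_square)
    have 4: "gradient F x \<bullet> (t *\<^sub>R v) = t * (gradient F x \<bullet> d) + t\<^sup>2 / 2 * (gradient F x \<bullet> u)"
      by (simp add: v_def algebra_simps power2_eq_square inner_add_right)
    show ?thesis
      using 1 2 unfolding 3 4 distrib_left abs_le_iff by linarith
  qed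
  then show ?thesis
    using \<open>\<tau> > 0\<close> unfolding eventually_at_right_field by blast
qed

text \<open>The lowest-order term that does not cancel decides the sign: the gap
  \<open>F x - c\<close>, then the slope along \<open>d\<close>, then the second-order coefficient.
  Compactness of \<open>U\<close> gives that coefficient a maximum, so one bound serves all
  \<open>u\<close>. The uses are \<open>c = f xs\<close> for the objective and \<open>c = 0\<close>
  for the inequality constraints.\<close>

lemma eventually_less_along_parabola:
  assumes F: "twice_continuously_differentiable F" and U: "compact U"
    and "F x \<le> c"
    and first: "F x = c \<Longrightarrow> gradient F x \<bullet> d \<le> 0"
    and second: "\<And>u. F x = c \<Longrightarrow> gradient F x \<bullet> d = 0 \<Longrightarrow> u \<in> U \<Longrightarrow>
      gradient F x \<bullet> u + d \<bullet> (hessian F x *v d) < 0"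
  shows "\<forall>\<^sub>F t in at_right 0. \<forall>u\<in>U. F (x + t *\<^sub>R d + (t\<^sup>2 / 2) *\<^sub>R u) < c"
proof (cases "U = {}")
  case False
  let ?k = "\<lambda>u. gradient F x \<bullet> u + d \<bullet> (hessian F x *v d)"
  have "continuous_on U ?k" by (intro continuous_intros)
  then obtain u0 where "u0 \<in> U" and u0: "\<And>u. u \<in> U \<Longrightarrow> ?k u \<le> ?k u0"
    using continuous_attains_sup[OF U False] by blast
  define m where "m = ?k u0"
  let ?P = "\<lambda>e t. F x + t * (gradient F x \<bullet> d) + t\<^sup>2 / 2 * m + e * t\<^sup>2"
  have bound: "\<forall>\<^sub>F t in at_right 0. \<forall>u\<in>U. F (x + t *\<^sub>R d + (t\<^sup>2 / 2) *\<^sub>R u) \<le> ?P e t" if "e > 0" for e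
    using second_order_expansion[OF F compact_imp_bounded[OF U] that, of x d]
  proof eventually_elim
    case (elim t)
    show ?case
    proof
      fix u assume "u \<in> U"
      then have "t\<^sup>2 / 2 * ?k u \<le> t\<^sup>2 / 2 * m"
        using u0 unfolding m_def by (intro mult_left_mono) auto
      then show "F (x + t *\<^sub>R d + (t\<^sup>2 / 2) *\<^sub>R u) \<le> ?P e t"
        using elim[rule_format, OF \<open>u \<in> U\<close>] by linarith
    qed
  qed
  have "\<exists>e>0. \<forall>\<^sub>F t in at_right 0. ?P e t < c"
  proof -
    consider "F x < c" | "F x = c" "gradient F x \<bullet> d < 0" | "F x = c" "gradient F x \<bullet> d = 0"
      using \<open>F x \<le> c\<close> first by fastforce
    then show ?thesis
    proof cases
      case 1
      have "(?P 1 \<longlongrightarrow> F x + 0 * (gradient F x \<bullet> d) + 0\<^sup>2 / 2 * m + 1 * 0\<^sup>2) (at_right 0)"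
        by (intro tendsto_intros) auto
      then have "\<forall>\<^sub>F t in at_right 0. ?P 1 t < c"
        using 1 by (intro order_tendstoD(2)[of "?P 1"]) auto
      then show ?thesis using zero_less_one by blast
    next
      case 2
      have "((\<lambda>t. gradient F x \<bullet> d + t * (m / 2 + 1)) \<longlongrightarrow> gradient F x \<bullet> d + 0 * (m / 2 + 1)) (at_right 0)"
        by (intro tendsto_intros)
      then have "\<forall>\<^sub>F t in at_right 0. gradient F x \<bullet> d + t * (m / 2 + 1) < 0"
        using 2 by (intro order_tendstoD(2)[where f = "\<lambda>t. gradient F x \<bullet> d + t * (m / 2 + 1)"]) auto
      then have "\<forall>\<^sub>F t in at_right 0. ?P 1 t < c"
        using eventually_at_right_less[of "0::real"]
      proof eventually_elim
        case (elim t)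
        then have "t * (gradient F x \<bullet> d + t * (m / 2 + 1)) < 0" by (simp add: mult_pos_neg)
        then show ?case using 2 by (simp add: algebra_simps power2_eq_square)
      qed
      then show ?thesis using zero_less_one by blast
    next
      case 3
      then have "m < 0" using second \<open>u0 \<in> U\<close> unfolding m_def by blast
      \<comment> \<open>With this \<open>e\<close> the coefficient of \<open>t\<^sup>2\<close> is
        \<open>m / 2 - m / 4 = m / 4\<close>, still negative.\<close>
      have "\<forall>\<^sub>F t in at_right 0. ?P (- m / 4) t < c"
        using eventually_at_right_less[of "0::real"]
      proof eventually_elim
        case (elim t)
        then have "t\<^sup>2 * m < 0" using \<open>m < 0\<close> by (simp add: mult_pos_neg)
        then show ?case using 3 by (simp add: algebra_simps)
      qed
      then show ?thesis using \<open>m < 0\<close> by (intro exI[of _ "- m / 4"]) auto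
    qed
  qed
  then obtain e where "e > 0" and e: "\<forall>\<^sub>F t in at_right 0. ?P e t < c" by blast
  show ?thesis
    using bound[OF \<open>e > 0\<close>] e by eventually_elim fastforce
qed simp

subsection \<open>Dines' theorem and pencils of quadratic forms\<close>

text \<open>The main case of Dines' theorem, where the images of \<open>x\<close> and
  \<open>y\<close> are linearly independent. Some point on the line \<open>x + t *\<^sub>R y\<close>
  has its image on the open ray through the convex combination; rescaling that point by a square
  root hits the combination itself.\<close>

lemma quadratic_form_image_segment:
  fixes P Q :: "real ^ 'n ^ 'n"
  defines "p \<equiv> \<lambda>d. d \<bullet> (P *v d)" and "q \<equiv> \<lambda>d. d \<bullet> (Q *v d)"
  assumes V: "subspace V" "x \<in> V" "y \<in> V" and s: "0 < s" "s < 1"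
    and det: "p x * q y - p y * q x \<noteq> 0"
  shows "\<exists>z\<in>V. p z = (1 - s) * p x + s * p y \<and> q z = (1 - s) * q x + s * q y"
proof -
  define w1 w2 where "w1 = (1 - s) * p x + s * p y" and "w2 = (1 - s) * q x + s * q y"
  define m1 m2 where "m1 = x \<bullet> (P *v y) + y \<bullet> (P *v x)" and "m2 = x \<bullet> (Q *v y) + y \<bullet> (Q *v x)"
  define D where "D = p x * q y - p y * q x"
  have p: "p (x + t *\<^sub>R y) = p x + t * m1 + t\<^sup>2 * p y" for t
    by (simp add: p_def m1_def matrix_vector_right_distrib matrix_vector_mult_scaleR inner_add_left
        inner_add_right algebra_simps power2_eq_square)
  have q: "q (x + t *\<^sub>R y) = q x + t * m2 + t\<^sup>2 * q y" for t
    by (simp add: q_def m2_def matrix_vector_right_distrib matrix_vector_mult_scaleR inner_add_left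
        inner_add_right algebra_simps power2_eq_square)
  have hom: "p (c *\<^sub>R z) = c\<^sup>2 * p z" "q (c *\<^sub>R z) = c\<^sup>2 * q z" for c z
    by (simp_all add: p_def q_def matrix_vector_mult_scaleR power2_eq_square)
  \<comment> \<open>Along \<open>x + t y\<close> the image is parallel to \<open>(w1, w2)\<close> exactly at the two roots, of opposite
    sign, of a quadratic in \<open>t\<close>; eliminating \<open>m1, m2\<close> between both shows that
    it points in the right direction at one of them.\<close>
  define l where "l = (\<lambda>a b. w1 * b - w2 * a)"
  have lx: "l (p x) (q x) = - s * D" and ly: "l (p y) (q y) = (1 - s) * D"
    by (simp_all add: l_def w1_def w2_def D_def algebra_simps)
  define b where "b = l m1 m2 / D"
  define r where "r = sqrt (b\<^sup>2 + 4 * s * (1 - s))"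
  have "\<bar>b\<bar> < r" unfolding r_def using s by (intro real_less_rsqrt) (auto simp: power2_abs)
  have r2: "r\<^sup>2 = b\<^sup>2 + 4 * s * (1 - s)" unfolding r_def using s by simp
  \<comment> \<open>\<open>- t1\<close> and \<open>t2\<close> are the roots of
    \<open>(1 - s) * t\<^sup>2 + b * t - s\<close>, which up to the factor \<open>D\<close> is the
    determinant of \<open>(w1, w2)\<close> with the image of
    \<open>x + t *\<^sub>R y\<close>.\<close>
  define t1 t2 where "t1 = (r + b) / (2 * (1 - s))" and "t2 = (r - b) / (2 * (1 - s))"
  have t: "t1 > 0" "t2 > 0" using \<open>\<bar>b\<bar> < r\<close> s by (auto simp: t1_def t2_def)
  have root1: "(1 - s) * t1\<^sup>2 - b * t1 - s = 0" and root2: "(1 - s) * t2\<^sup>2 + b * t2 - s = 0"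
  proof -
    have 1: "2 * (1 - s) * t1 = r + b" and 2: "2 * (1 - s) * t2 = r - b"
      using s by (simp_all add: t1_def t2_def)
    have "4 * (1 - s) * ((1 - s) * t1\<^sup>2 - b * t1 - s)
        = (2 * (1 - s) * t1)\<^sup>2 - 2 * b * (2 * (1 - s) * t1) - 4 * s * (1 - s)"
      by (simp add: power2_eq_square algebra_simps)
    also have "\<dots> = 0" unfolding 1 using r2 by (simp add: power2_eq_square algebra_simps)
    finally show "(1 - s) * t1\<^sup>2 - b * t1 - s = 0" using s by simp
    have "4 * (1 - s) * ((1 - s) * t2\<^sup>2 + b * t2 - s)
        = (2 * (1 - s) * t2)\<^sup>2 + 2 * b * (2 * (1 - s) * t2) - 4 * s * (1 - s)"
      by (simp add: power2_eq_square algebra_simps)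
    also have "\<dots> = 0" unfolding 2 using r2 by (simp add: power2_eq_square algebra_simps)
    finally show "(1 - s) * t2\<^sup>2 + b * t2 - s = 0" using s by simp
  qed
  have "D \<noteq> 0" using det by (simp add: D_def)
  then have lm: "l m1 m2 = b * D" by (simp add: b_def)
  have par: "w1 * q (x + t *\<^sub>R y) - w2 * p (x + t *\<^sub>R y) = D * ((1 - s) * t\<^sup>2 + b * t - s)" for t
  proof -
    have "w1 * q (x + t *\<^sub>R y) - w2 * p (x + t *\<^sub>R y)
        = l (p x) (q x) + t * l m1 m2 + t\<^sup>2 * l (p y) (q y)"
      unfolding p q l_def by (simp add: algebra_simps)
    then show ?thesis unfolding lx ly lm by (simp add: algebra_simps)
  qed
  \<comment> \<open>Once the image is parallel to \<open>(w1, w2)\<close>, determinants against the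
    image of \<open>y\<close> fix the factor: they are \<open>k * D\<close> for the point and
    \<open>(1 - s) * D\<close> for \<open>(w1, w2)\<close>. The factor \<open>(1 - s) / k\<close> is
    therefore positive and has a square root to scale by.\<close>
  have good: ?thesis if par: "w1 * q (x + t *\<^sub>R y) = w2 * p (x + t *\<^sub>R y)"
    and pos: "p (x + t *\<^sub>R y) * q y - p y * q (x + t *\<^sub>R y) = k * D" "k > 0" for t k
  proof -
    let ?z = "x + t *\<^sub>R y"
    have w: "w1 * q y - p y * w2 = (1 - s) * D"
      by (simp add: w1_def w2_def D_def algebra_simps)
    have "(1 - s) * D * p ?z = k * D * w1"
    proof -
      have "(1 - s) * D * p ?z - k * D * w1 = p y * (w1 * q ?z - w2 * p ?z)"
        unfolding w[symmetric] pos(1)[symmetric] by (simp add: algebra_simps)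
      then show ?thesis using par by simp
    qed
    then have "D * ((1 - s) * p ?z) = D * (k * w1)" by (simp only: mult_ac)
    then have 1: "w1 = (1 - s) / k * p ?z"
      using \<open>D \<noteq> 0\<close> \<open>k > 0\<close> by (simp add: nonzero_eq_divide_eq mult.commute)
    have "(1 - s) * D * q ?z = k * D * w2"
    proof -
      have "(1 - s) * D * q ?z - k * D * w2 = q y * (w1 * q ?z - w2 * p ?z)"
        unfolding w[symmetric] pos(1)[symmetric] by (simp add: algebra_simps)
      then show ?thesis using par by simp
    qed
    then have "D * ((1 - s) * q ?z) = D * (k * w2)" by (simp only: mult_ac)
    then have 2: "w2 = (1 - s) / k * q ?z"
      using \<open>D \<noteq> 0\<close> \<open>k > 0\<close> by (simp add: nonzero_eq_divide_eq mult.commute)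
    have c: "(sqrt ((1 - s) / k))\<^sup>2 = (1 - s) / k" using s \<open>k > 0\<close> by simp
    have "sqrt ((1 - s) / k) *\<^sub>R ?z \<in> V"
      using V by (simp add: subspace_add subspace_scale)
    moreover have "p (sqrt ((1 - s) / k) *\<^sub>R ?z) = w1" "q (sqrt ((1 - s) / k) *\<^sub>R ?z) = w2"
      unfolding hom c using 1 2 by simp_all
    ultimately show ?thesis unfolding w1_def w2_def by blast
  qed
  \<comment> \<open>Against the image of \<open>y\<close> the quadratic term in \<open>t\<close>
    drops out, leaving \<open>D\<close> times the affine function \<open>1 + t * M\<close>. It
    equals 1 at 0, hence is positive at one of two points on opposite sides of 0.\<close>
  define M where "M = (m1 * q y - p y * m2) / D"
  have detx: "p (x + t *\<^sub>R y) * q y - p y * q (x + t *\<^sub>R y) = (1 + t * M) * D" for t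
    unfolding p q M_def using \<open>D \<noteq> 0\<close> by (simp add: field_simps) (simp add: D_def algebra_simps)
  have "1 + t2 * M > 0 \<or> 1 + (- t1) * M > 0"
  proof (cases "M \<ge> 0")
    case True
    then have "t2 * M \<ge> 0" using t by simp
    then show ?thesis by linarith
  next
    case False
    then have "t1 * M < 0" using t by (simp add: mult_pos_neg)
    then show ?thesis by simp
  qed
  then show ?thesis
  proof
    assume "1 + t2 * M > 0"
    then show ?thesis using good[of t2 "1 + t2 * M"] par[of t2] root2 detx by simp
  next
    assume "1 + (- t1) * M > 0"
    then show ?thesis using good[of "- t1" "1 + (- t1) * M"] par[of "- t1"] root1 detx[of "- t1"] by simp
  qed
qed

text \<open>Dines' theorem. Linearly dependent images lie on one line through the origin, where a
  convex combination is a nonnegative multiple of one of them; homogeneity of degree 2 then supplies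
  a preimage.\<close>

lemma quadratic_form_image_convex:
  fixes P Q :: "real ^ 'n ^ 'n"
  assumes V: "subspace V"
  shows "convex ((\<lambda>d. (d \<bullet> (P *v d), d \<bullet> (Q *v d))) ` V)"
proof -
  define p q where "p = (\<lambda>d. d \<bullet> (P *v d))" and "q = (\<lambda>d. d \<bullet> (Q *v d))"
  have hom: "p (c *\<^sub>R z) = c\<^sup>2 * p z" "q (c *\<^sub>R z) = c\<^sup>2 * q z" for c z
    by (simp_all add: p_def q_def matrix_vector_mult_scaleR power2_eq_square)
  have "\<exists>z\<in>V. p z = (1 - s) * p x + s * p y \<and> q z = (1 - s) * q x + s * q y"
    if x: "x \<in> V" and y: "y \<in> V" and s: "0 \<le> s" "s \<le> 1" for x y s
  proof (cases "s = 0 \<or> s = 1 \<or> p x * q y - p y * q x \<noteq> 0")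
    case True
    then show ?thesis
      using quadratic_form_image_segment[of V x y s P Q] V x y s
      unfolding p_def q_def by (metis (lifting) add.left_neutral add.right_neutral diff_zero
          diff_self less_le mult_1 mult_zero_left)
  next
    case False
    then have dep: "p x * q y = p y * q x" by simp
    have scaled: ?thesis
      if "u \<in> V" and k: "(1 - s) * p x + s * p y = k * p u" "(1 - s) * q x + s * q y = k * q u" "k \<ge> 0" for k u
      using that V by (intro bexI[of _ "sqrt k *\<^sub>R u"]) (auto simp: hom subspace_scale)
    show ?thesis
    proof (cases "p x = 0 \<and> q x = 0")
      case True
      then show ?thesis using scaled[OF y, of s] s by simp
    next
      case x0: False
      then obtain c where c: "p y = c * p x" "q y = c * q x"
        using dep by (metis mult.commute nonzero_mult_div_cancel_right times_divide_eq_left divide_self_if mult_cancel_right1)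
      show ?thesis
      \<comment> \<open>The combination is \<open>1 - s + s * c\<close> times the image of
        \<open>x\<close>. If that factor is negative then so is \<open>c\<close>, and dividing by
        \<open>c\<close> gives a nonnegative multiple of the image of \<open>y\<close>
        instead.\<close>
      proof (cases "1 - s + s * c \<ge> 0")
        case True
        then show ?thesis using scaled[OF x, of "1 - s + s * c"] c by (simp add: algebra_simps)
      next
        case neg: False
        then have "s * c < 0" using s by linarith
        then have "c < 0" using s by (simp add: mult_less_0_iff)
        have "(1 - s + s * c) / c \<ge> 0" using \<open>c < 0\<close> neg by (simp add: divide_nonpos_neg)
        moreover have "(1 - s) * p x + s * p y = (1 - s + s * c) / c * p y"
          "(1 - s) * q x + s * q y = (1 - s + s * c) / c * q y"
          using c \<open>c < 0\<close> by (simp_all add: field_simps)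
        ultimately show ?thesis using scaled[OF y] by blast
      qed
    qed
  qed
  then show ?thesis
    unfolding convex_alt p_def q_def by (auto simp: image_iff Bex_def) metis
qed

section \<open>Minimax over a convex cone\<close>

text \<open>A negative \<open>r\<close> would make \<open>k * r\<close> fall below any fixed
  \<open>e\<close>. Along rays, a lower bound thus becomes nonnegativity.\<close>

lemma nonneg_of_scaled_bound:
  fixes r e :: real
  assumes "\<And>k. k > 0 \<Longrightarrow> e \<le> k * r"
  shows "0 \<le> r"
proof (rule ccontr)
  assume "\<not> 0 \<le> r"
  then have "e \<le> (\<bar>e\<bar> + 1) / (- r) * r" by (intro assms divide_pos_pos) auto
  then show False using \<open>\<not> 0 \<le> r\<close> by simp
qed

text \<open>If \<open>C\<close> misses the dual cone \<open>W'\<close> of \<open>W\<close>, a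
  hyperplane separates them strictly. Its normal \<open>a\<close> is negative on \<open>C\<close>
  and nonnegative on \<open>W'\<close>, so by the bipolar theorem it lies in the closure of
  \<open>W\<close>. A nearby point of \<open>W\<close> is still negative against all of
  \<open>C\<close>, contradicting the pointwise assumption.\<close>

lemma cone_minimax:
  fixes C W :: "'a::euclidean_space set"
  assumes C: "compact C" "convex C" and W: "convex W" "cone W" "W \<noteq> {}"
    and *: "\<And>z. z \<in> W \<Longrightarrow> \<exists>c\<in>C. 0 \<le> c \<bullet> z"
  shows "\<exists>c\<in>C. \<forall>z\<in>W. 0 \<le> c \<bullet> z"
proof (rule ccontr)
  assume no: "\<not> ?thesis"
  define W' where "W' = {c. \<forall>z\<in>W. 0 \<le> c \<bullet> z}"
  have "W' = (\<Inter>z\<in>W. {c. 0 \<le> z \<bullet> c})" by (auto simp: W'_def inner_commute)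
  then have W': "closed W'" "convex W'"
    by (auto intro!: closed_INT convex_INT
      closed_halfspace_ge[where b = 0, simplified] convex_halfspace_ge[where b = 0, simplified])
  have "C \<noteq> {}" using * W by blast
  have "C \<inter> W' = {}" using no by (auto simp: W'_def)
  then obtain a b where a: "\<And>c. c \<in> C \<Longrightarrow> a \<bullet> c < b" "\<And>c. c \<in> W' \<Longrightarrow> b < a \<bullet> c"
    using separating_hyperplane_compact_closed[OF C(2,1) \<open>C \<noteq> {}\<close> W'(2,1)] by blast
  have "b < 0" using a(2)[of 0] by (simp add: W'_def)
  have aW': "0 \<le> a \<bullet> c" if "c \<in> W'" for c
  proof (rule nonneg_of_scaled_bound)
    show "b \<le> k * (a \<bullet> c)" if "k > 0" for k
      using a(2)[of "k *\<^sub>R c"] that \<open>c \<in> W'\<close> by (auto simp: W'_def)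
  qed
  have "a \<in> closure W"
  proof (rule ccontr)
    assume "a \<notin> closure W"
    then obtain e r where e: "e \<bullet> a < r" "\<And>z. z \<in> closure W \<Longrightarrow> r < e \<bullet> z"
      using separating_hyperplane_closed_point[of "closure W" a] W by (auto intro: convex_closure)
    have "0 \<in> W" using W by (meson cone_contains_0)
    then have "r < 0" using e(2)[of 0] closure_subset by auto
    have "0 \<le> e \<bullet> z" if "z \<in> W" for z
    proof (rule nonneg_of_scaled_bound)
      fix k :: real assume "k > 0"
      then have "k *\<^sub>R z \<in> W" using W that by (simp add: cone_def)
      then show "r \<le> k * (e \<bullet> z)" using e(2)[OF subsetD[OF closure_subset \<open>k *\<^sub>R z \<in> W\<close>]] by simp
    qed
    then have "e \<in> W'" by (simp add: W'_def)
    then show False using aW'[of e] e(1) \<open>r < 0\<close> by (simp add: inner_commute)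
  qed
  obtain B where "B > 0" and B: "\<And>c. c \<in> C \<Longrightarrow> norm c \<le> B"
    using C compact_imp_bounded bounded_pos by metis
  \<comment> \<open>Moving from \<open>a\<close> to \<open>z\<close> within the radius
    \<open>- b / B\<close> raises the inner product with any \<open>c\<close> in \<open>C\<close> by
    less than \<open>- b\<close>, while \<open>a \<bullet> c < b\<close>.\<close>
  obtain z where "z \<in> W" and z: "dist z a < - b / B"
    using \<open>a \<in> closure W\<close> \<open>b < 0\<close> \<open>B > 0\<close> unfolding closure_approachable by (meson divide_pos_pos neg_0_less_iff_less)
  obtain c where "c \<in> C" and c: "0 \<le> c \<bullet> z" using * \<open>z \<in> W\<close> by blast
  have "c \<bullet> (z - a) \<le> norm c * norm (z - a)" by (rule norm_cauchy_schwarz)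
  also have "\<dots> \<le> B * norm (z - a)" using B[OF \<open>c \<in> C\<close>] by (intro mult_right_mono) auto
  also have "\<dots> < - b" using z \<open>B > 0\<close> by (simp add: dist_norm field_simps)
  finally show False using a(1)[OF \<open>c \<in> C\<close>] c by (simp add: inner_diff_right inner_commute)
qed

text \<open>This is the expansion in an orthonormal basis of the span, padded by 0 when the basis
  has fewer than two elements.\<close>

lemma dim_le_2_expansion:
  fixes M :: "'a::euclidean_space set"
  assumes "dim M \<le> 2"
  shows "\<exists>P Q. \<forall>A\<in>span M. A = (A \<bullet> P) *\<^sub>R P + (A \<bullet> Q) *\<^sub>R Q"
proof -
  obtain B where B: "pairwise orthogonal B" "\<And>b. b \<in> B \<Longrightarrow> norm b = 1" "independent B"
    "card B = dim (span M)" "span B = span M"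
    using orthonormal_basis_subspace[OF subspace_span, of M] by metis
  have "finite B" using B(3) by (rule independent_imp_finite)
  have ex: "A = (\<Sum>b\<in>B. (A \<bullet> b) *\<^sub>R b)" if "A \<in> span M" for A
    using orthonormal_basis_expand[OF B(1,2) _ \<open>finite B\<close>, of A] B(5) that by simp
  have "card B = 0 \<or> card B = 1 \<or> card B = 2" using B(4) assms unfolding dim_span by linarith
  then consider "B = {}" | P where "B = {P}" | P Q where "B = {P, Q}" "P \<noteq> Q"
    using \<open>finite B\<close> by (metis card_0_eq card_1_singletonE card_2_iff)
  then show ?thesis
  proof cases
    case 1 then show ?thesis using ex by (intro exI[of _ 0]) auto
  next
    case (2 P) then show ?thesis using ex by (intro exI[of _ P] exI[of _ 0]) auto
  next
    case (3 P Q) then show ?thesis using ex by (intro exI[of _ P] exI[of _ Q]) auto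
  qed
qed

text \<open>In the coordinates \<open>(A \<bullet> P, A \<bullet> Q)\<close> the quadratic form of
  \<open>A\<close> at \<open>d\<close> is a planar inner product with the pair of values of the
  forms \<open>P\<close> and \<open>Q\<close> at \<open>d\<close>. These pairs form a convex cone by
  Dines' theorem, so \<open>cone_minimax\<close> in the plane exchanges the quantifiers.\<close>

lemma psd_on_subspace_of_rank_2:
  fixes C :: "(real ^ 'n ^ 'n) set"
  assumes C: "compact C" "convex C" "C \<subseteq> span M" "dim M \<le> 2" and V: "subspace V"
    and *: "\<And>d. d \<in> V \<Longrightarrow> \<exists>A\<in>C. 0 \<le> d \<bullet> (A *v d)"
  shows "\<exists>A\<in>C. \<forall>d\<in>V. 0 \<le> d \<bullet> (A *v d)"
proof -
  obtain P Q where PQ: "\<And>A. A \<in> C \<Longrightarrow> A = (A \<bullet> P) *\<^sub>R P + (A \<bullet> Q) *\<^sub>R Q"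
    using dim_le_2_expansion[OF C(4)] C(3) by blast
  define \<phi> where "\<phi> = (\<lambda>d. (d \<bullet> (P *v d), d \<bullet> (Q *v d)))"
  define \<psi> :: "real ^ 'n ^ 'n \<Rightarrow> real \<times> real" where "\<psi> = (\<lambda>A. (A \<bullet> P, A \<bullet> Q))"
  have eq: "d \<bullet> (A *v d) = \<psi> A \<bullet> \<phi> d" if "A \<in> C" for A d
    by (subst PQ[OF that])
      (simp add: \<phi>_def \<psi>_def matrix_vector_mult_add_rdistrib scaleR_matrix_vector_assoc[symmetric] inner_add_right)
  have lin: "linear \<psi>"
    unfolding \<psi>_def by (intro linearI) (auto simp: inner_add_left)
  have "\<exists>c\<in>\<psi> ` C. \<forall>z\<in>\<phi> ` V. 0 \<le> c \<bullet> z"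
  proof (rule cone_minimax)
    show "compact (\<psi> ` C)" using lin C(1) by (simp add: compact_continuous_image linear_continuous_on linear_conv_bounded_linear)
    show "convex (\<psi> ` C)" using lin C(2) by (simp add: convex_linear_image)
    show "convex (\<phi> ` V)" unfolding \<phi>_def by (rule quadratic_form_image_convex[OF V])
    show "cone (\<phi> ` V)"
      unfolding cone_def
    proof (intro ballI allI impI)
      fix z and c :: real assume "z \<in> \<phi> ` V" "c \<ge> 0"
      then obtain d where "d \<in> V" and z: "z = \<phi> d" by blast
      then have "c *\<^sub>R \<phi> d = \<phi> (sqrt c *\<^sub>R d)" "sqrt c *\<^sub>R d \<in> V"
        using V \<open>c \<ge> 0\<close> by (auto simp: \<phi>_def matrix_vector_mult_scaleR subspace_scale mult.assoc[symmetric])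
      then show "c *\<^sub>R z \<in> \<phi> ` V" unfolding z by blast
    qed
    show "\<phi> ` V \<noteq> {}" using V subspace_0 by blast
    show "\<exists>c\<in>\<psi> ` C. 0 \<le> c \<bullet> z" if "z \<in> \<phi> ` V" for z
      using that * eq by fastforce
  qed
  then show ?thesis using eq by fastforce
qed

subsection \<open>Second-order necessary conditions\<close>

lemma sum_matrix_vector_mult:
  fixes A :: "'i \<Rightarrow> real ^ 'n ^ 'm"
  shows "(\<Sum>i\<in>X. c i *\<^sub>R A i) *v z = (\<Sum>i\<in>X. c i *\<^sub>R (A i *v z))"
  by (induction X rule: infinite_finite_induct)
    (simp_all add: matrix_vector_mult_add_rdistrib flip: scaleR_matrix_vector_assoc)

section \<open>Derivatives of the Lagrangian and the multiplier conditions\<close>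

locale nlp_minimizer =
  fixes f :: "real ^ 'n \<Rightarrow> real"
    and h :: "'p::finite \<Rightarrow> real ^ 'n \<Rightarrow> real" and E :: "'p set"
    and g :: "'q::finite \<Rightarrow> real ^ 'n \<Rightarrow> real" and I :: "'q set"
    and xs :: "real ^ 'n"
  assumes smooth_f: "twice_continuously_differentiable f"
    and smooth_h: "\<And>i. i \<in> E \<Longrightarrow> twice_continuously_differentiable (h i)"
    and smooth_g: "\<And>j. j \<in> I \<Longrightarrow> twice_continuously_differentiable (g j)"
    and minimizer: "local_minimizer f E h I g xs"
    and mfcq: "MFCQ E h I g xs"
begin

abbreviation A where "A \<equiv> active_set I g xs"

abbreviation curvature where "curvature F d \<equiv> d \<bullet> (hessian F xs *v d)"

lemma feasible: "feasible E h I g xs"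
  using mfcq by (simp add: MFCQ_def)

lemma mfcqD:
  assumes "(\<Sum>i\<in>E. \<alpha> i *\<^sub>R gradient (h i) xs) + (\<Sum>j\<in>A. \<beta> j *\<^sub>R gradient (g j) xs) = 0"
    and "\<And>j. j \<in> A \<Longrightarrow> \<beta> j \<ge> 0"
  shows "i \<in> E \<Longrightarrow> \<alpha> i = 0" "j \<in> A \<Longrightarrow> \<beta> j = 0"
  using assms mfcq unfolding MFCQ_def by blast+

lemma gradient_lagrangian:
  "gradient (lagrangian f E h I g lam mu) x
    = gradient f x + (\<Sum>i\<in>E. lam $ i *\<^sub>R gradient (h i) x) + (\<Sum>j\<in>I. mu $ j *\<^sub>R gradient (g j) x)"
proof (rule gradient_eqI)
  have grad: "(F has_derivative (\<lambda>z. z \<bullet> gradient F x)) (at x)"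
    if "twice_continuously_differentiable F" for F
    using gradient_works that unfolding twice_continuously_differentiable_def gderiv_def by blast
  show "GDERIV (lagrangian f E h I g lam mu) x :>
      gradient f x + (\<Sum>i\<in>E. lam $ i *\<^sub>R gradient (h i) x) + (\<Sum>j\<in>I. mu $ j *\<^sub>R gradient (g j) x)"
    unfolding gderiv_def lagrangian_def inner_add_right inner_sum_right inner_scaleR_right
    by (intro has_derivative_add has_derivative_sum has_derivative_mult_right grad
        smooth_f smooth_h smooth_g)
qed

lemma hessian_lagrangian:
  "hessian (lagrangian f E h I g lam mu) xs
    = hessian f xs + ((\<Sum>i\<in>E. lam $ i *\<^sub>R hessian (h i) xs) + (\<Sum>j\<in>I. mu $ j *\<^sub>R hessian (g j) xs))"
    (is "_ = ?H")
proof -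
  have hess: "(gradient F has_derivative (\<lambda>z. hessian F xs *v z)) (at xs)"
    if "twice_continuously_differentiable F" for F
    using that unfolding twice_continuously_differentiable_def hessian_def by (metis jacobian_works)
  have "(gradient (lagrangian f E h I g lam mu) has_derivative (\<lambda>z. ?H *v z)) (at xs)"
    unfolding gradient_lagrangian[abs_def] add.assoc[symmetric]
    unfolding matrix_vector_mult_add_rdistrib sum_matrix_vector_mult
    by (intro has_derivative_add has_derivative_sum has_derivative_scaleR_right hess
        smooth_f smooth_h smooth_g)
  then show ?thesis
    unfolding hessian_def[of "lagrangian f E h I g lam mu"] jacobian_def
    by (simp only: frechet_derivative_at[symmetric] matrix_of_matrix_vector_mul)
qed

text \<open>At a feasible point every \<open>mu $ j * g j xs\<close> is nonpositive, so the sum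
  vanishes only if each term does: complementarity means that \<open>mu\<close> is supported on the
  active set.\<close>

lemma multiplier_set_iff:
  "(lam, mu) \<in> multiplier_set f E h I g xs \<longleftrightarrow>
     (\<forall>i. i \<notin> E \<longrightarrow> lam $ i = 0) \<and> (\<forall>j. j \<notin> A \<longrightarrow> mu $ j = 0) \<and> (\<forall>j. 0 \<le> mu $ j) \<and>
     gradient f xs + (\<Sum>i\<in>E. lam $ i *\<^sub>R gradient (h i) xs) + (\<Sum>j\<in>A. mu $ j *\<^sub>R gradient (g j) xs) = 0"
proof -
  have AI: "A \<subseteq> I" by (auto simp: active_set_def)
  have sum: "(\<Sum>j\<in>I. mu $ j *\<^sub>R gradient (g j) xs) = (\<Sum>j\<in>A. mu $ j *\<^sub>R gradient (g j) xs)"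
    if "\<forall>j. j \<notin> A \<longrightarrow> mu $ j = 0"
    by (rule sum.mono_neutral_right) (use that AI in auto)
  have compl: "(\<Sum>j\<in>I. mu $ j * g j xs) = 0 \<longleftrightarrow> (\<forall>j\<in>I. mu $ j * g j xs = 0)" if "\<forall>j\<in>I. 0 \<le> mu $ j"
  proof -
    have "(\<Sum>j\<in>I. mu $ j * g j xs) = - (\<Sum>j\<in>I. mu $ j * (- g j xs))"
      by (simp add: sum_negf)
    moreover have "(\<Sum>j\<in>I. mu $ j * (- g j xs)) = 0 \<longleftrightarrow> (\<forall>j\<in>I. mu $ j * (- g j xs) = 0)"
      using that feasible unfolding feasible_def
      by (intro sum_nonneg_eq_0_iff mult_nonneg_nonneg) auto
    ultimately show ?thesis by simp
  qed
  have "(lam, mu) \<in> multiplier_set f E h I g xs \<longleftrightarrow>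
     (\<forall>i. i \<notin> E \<longrightarrow> lam $ i = 0) \<and> (\<forall>j. j \<notin> A \<longrightarrow> mu $ j = 0) \<and> (\<forall>j. 0 \<le> mu $ j) \<and>
     gradient (lagrangian f E h I g lam mu) xs = 0"
    unfolding multiplier_set_def mem_Collect_eq prod.case
    using compl by (auto simp: active_set_def)
  then show ?thesis unfolding gradient_lagrangian using sum by auto
qed

section \<open>Absence of second-order descent\<close>

text \<open>MFCQ with \<open>\<beta>\<close> zero makes the equality gradients linearly independent.
  Moving along \<open>G y\<close> adjusts each linearized equality constraint separately.\<close>

lemma equality_gradients_right_inverse:
  "\<exists>G :: real ^ 'p \<Rightarrow> real ^ 'n. linear G \<and> (\<forall>y. \<forall>i\<in>E. gradient (h i) xs \<bullet> G y = y $ i)"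
proof -
  \<comment> \<open>The extra argument \<open>e\<close> fills the coordinates outside
    \<open>E\<close>, so that \<open>T\<close> can be onto the whole space.\<close>
  define T :: "(real ^ 'n) \<times> (real ^ 'p) \<Rightarrow> real ^ 'p" where
    "T = (\<lambda>(w, e). \<chi> i. if i \<in> E then gradient (h i) xs \<bullet> w else e $ i)"
  have lin: "linear T"
    by (intro linearI) (auto simp: T_def vec_eq_iff inner_add_right)
  have "surj T"
  proof (rule ccontr)
    assume "\<not> surj T"
    then have "span (range T) \<noteq> UNIV"
      unfolding span_eq_iff[THEN iffD2, OF linear_subspace_image[OF lin subspace_UNIV]] .
    then have "dim (range T) < DIM(real ^ 'p)"
      using dim_eq_full[of "range T"] dim_subset_UNIV[of "range T"] by linarith
    then obtain a where "a \<noteq> 0" and a: "\<And>y. y \<in> span (range T) \<Longrightarrow> orthogonal a y"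
      by (rule orthogonal_to_subspace_exists) blast
    have aT: "a \<bullet> T z = 0" for z
      using a[OF span_base[OF rangeI]] by (simp add: orthogonal_def)
    have aE: "a $ i = 0" if "i \<notin> E" for i
    proof -
      have "T (0, axis i 1) = axis i 1"
        using that by (auto simp: T_def vec_eq_iff axis_def)
      then show ?thesis using aT[of "(0, axis i 1)"] by (simp add: inner_axis)
    qed
    define v where "v = (\<Sum>i\<in>E. a $ i *\<^sub>R gradient (h i) xs)"
    have "a \<bullet> T (v, 0) = (\<Sum>i\<in>E. a $ i * (gradient (h i) xs \<bullet> v))"
      unfolding inner_vec_def T_def by (simp add: if_distrib[of "(*) _"] sum.If_cases)
    also have "\<dots> = v \<bullet> v" by (simp add: v_def inner_sum_left)
    finally have "v = 0" using aT by simp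
    then have "a $ i = 0" if "i \<in> E" for i
      using mfcqD(1)[of "\<lambda>i. a $ i" "\<lambda>_. 0" i] that by (simp add: v_def)
    then show False using aE \<open>a \<noteq> 0\<close> by (auto simp: vec_eq_iff)
  qed
  then obtain R where R: "linear R" "T \<circ> R = id"
    using linear_surjective_right_inverse[OF lin] by blast
  have "gradient (h i) xs \<bullet> fst (R y) = y $ i" if "i \<in> E" for i y
  proof -
    have "T (R y) $ i = y $ i" using fun_cong[OF R(2), of y] by simp
    then show ?thesis using that by (simp add: T_def case_prod_unfold)
  qed
  moreover have "linear (\<lambda>y. fst (R y))"
    using linear_compose[OF R(1) linear_fst] by (simp add: o_def)
  ultimately show ?thesis by blast
qed

text \<open>The strict inequalities survive replacing \<open>w\<close> by \<open>w + G y\<close> for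
  all small \<open>y\<close>, while \<open>y\<close> shifts the equality constraints freely. Some
  \<open>y\<close> cancels their errors exactly, which gives a feasible point near \<open>xs\<close>
  with a smaller objective.\<close>

lemma no_second_order_descent:
  assumes d: "d \<in> critical_cone f E h I g xs"
  shows "\<not> (\<exists>w. gradient f xs \<bullet> w + curvature f d < 0 \<and>
    (\<forall>i\<in>E. gradient (h i) xs \<bullet> w + curvature (h i) d = 0) \<and>
    (\<forall>j\<in>A. gradient (g j) xs \<bullet> d = 0 \<longrightarrow> gradient (g j) xs \<bullet> w + curvature (g j) d < 0))"
proof
  let ?J = "{j \<in> A. gradient (g j) xs \<bullet> d = 0}"
  assume "\<exists>w. gradient f xs \<bullet> w + curvature f d < 0 \<and>
    (\<forall>i\<in>E. gradient (h i) xs \<bullet> w + curvature (h i) d = 0) \<and>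
    (\<forall>j\<in>A. gradient (g j) xs \<bullet> d = 0 \<longrightarrow> gradient (g j) xs \<bullet> w + curvature (g j) d < 0)"
  then obtain w where wf: "gradient f xs \<bullet> w + curvature f d < 0"
    and wh: "\<And>i. i \<in> E \<Longrightarrow> gradient (h i) xs \<bullet> w + curvature (h i) d = 0"
    and wg: "\<And>j. j \<in> ?J \<Longrightarrow> gradient (g j) xs \<bullet> w + curvature (g j) d < 0"
    by blast
  have df: "gradient f xs \<bullet> d = 0" and dh: "\<And>i. i \<in> E \<Longrightarrow> gradient (h i) xs \<bullet> d = 0"
    and dg: "\<And>j. j \<in> A \<Longrightarrow> gradient (g j) xs \<bullet> d \<le> 0"
    using d by (auto simp: critical_cone_def)
  obtain G :: "real ^ 'p \<Rightarrow> real ^ 'n" where G: "linear G"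
    and hG: "\<And>y i. i \<in> E \<Longrightarrow> gradient (h i) xs \<bullet> G y = y $ i"
    using equality_gradients_right_inverse by blast
  have contG: "continuous_on X (\<lambda>y. G y)" for X
    by (rule linear_continuous_on[OF G[unfolded linear_conv_bounded_linear]])
  define N where "N = (\<lambda>F. {y. gradient F xs \<bullet> (w + G y) + curvature F d < 0})"
  have "open (N f \<inter> (\<Inter>j\<in>?J. N (g j)))"
    unfolding N_def
    by (intro open_Int open_INT ballI open_Collect_less continuous_intros contG) auto
  moreover have "0 \<in> N f \<inter> (\<Inter>j\<in>?J. N (g j))"
    using wf wg by (simp add: N_def linear_0[OF G])
  ultimately obtain \<delta> where "\<delta> > 0" and \<delta>: "cball 0 \<delta> \<subseteq> N f \<inter> (\<Inter>j\<in>?J. N (g j))"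
    by (meson open_contains_cball)
  define U where "U = (\<lambda>y. w + G y) ` cball 0 \<delta>"
  have "compact U"
    unfolding U_def by (intro compact_continuous_image continuous_intros contG compact_cball)
  obtain \<epsilon> where "\<epsilon> > 0" and \<epsilon>: "\<And>y. y \<in> ball xs \<epsilon> \<Longrightarrow> feasible E h I g y \<Longrightarrow> f xs \<le> f y"
    using minimizer unfolding local_minimizer_def by blast
  let ?x = "\<lambda>t u. xs + t *\<^sub>R d + (t\<^sup>2 / 2) *\<^sub>R u"
  \<comment> \<open>Each coordinate of \<open>y - \<Psi> y\<close> below is at most
    \<open>2 * e\<close> in absolute value, so \<open>CARD('p)\<close> of them add up to at most
    \<open>\<delta>\<close>.\<close>
  define e where "e = \<delta> / (2 * real CARD('p))"
  have "e > 0" using \<open>\<delta> > 0\<close> by (simp add: e_def)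
  have 1: "\<forall>\<^sub>F t in at_right 0. \<forall>u\<in>U. f (?x t u) < f xs"
    by (rule eventually_less_along_parabola[OF smooth_f \<open>compact U\<close>])
      (use \<delta> df in \<open>auto simp: U_def N_def\<close>)
  have "\<forall>j\<in>I. \<forall>\<^sub>F t in at_right 0. \<forall>u\<in>U. g j (?x t u) < 0"
  proof
    fix j assume "j \<in> I"
    show "\<forall>\<^sub>F t in at_right 0. \<forall>u\<in>U. g j (?x t u) < 0"
      by (rule eventually_less_along_parabola[OF smooth_g[OF \<open>j \<in> I\<close>] \<open>compact U\<close>])
        (use \<delta> dg feasible \<open>j \<in> I\<close> in \<open>auto simp: U_def N_def feasible_def active_set_def\<close>)
  qed
  then have 2: "\<forall>\<^sub>F t in at_right 0. \<forall>j\<in>I. \<forall>u\<in>U. g j (?x t u) < 0"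
    by (simp add: eventually_ball_finite_distrib)
  have "\<forall>i\<in>E. \<forall>\<^sub>F t in at_right 0. \<forall>u\<in>U.
      \<bar>h i (?x t u) - t\<^sup>2 / 2 * (gradient (h i) xs \<bullet> u + curvature (h i) d)\<bar> \<le> e * t\<^sup>2"
  proof
    fix i assume "i \<in> E"
    then show "\<forall>\<^sub>F t in at_right 0. \<forall>u\<in>U.
      \<bar>h i (?x t u) - t\<^sup>2 / 2 * (gradient (h i) xs \<bullet> u + curvature (h i) d)\<bar> \<le> e * t\<^sup>2"
      using second_order_expansion[OF smooth_h compact_imp_bounded[OF \<open>compact U\<close>] \<open>e > 0\<close>, of i xs d]
        dh feasible by (simp add: feasible_def)
  qed
  then have 3: "\<forall>\<^sub>F t in at_right 0. \<forall>i\<in>E. \<forall>u\<in>U.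
      \<bar>h i (?x t u) - t\<^sup>2 / 2 * (gradient (h i) xs \<bullet> u + curvature (h i) d)\<bar> \<le> e * t\<^sup>2"
    by (simp add: eventually_ball_finite_distrib)
  obtain B where B: "\<And>u. u \<in> U \<Longrightarrow> norm u \<le> B"
    using compact_imp_bounded[OF \<open>compact U\<close>] unfolding bounded_iff by blast
  have "((\<lambda>t. t * norm d + t\<^sup>2 / 2 * B) \<longlongrightarrow> 0 * norm d + 0\<^sup>2 / 2 * B) (at_right 0)"
    by (intro tendsto_intros) auto
  then have 4: "\<forall>\<^sub>F t in at_right 0. t * norm d + t\<^sup>2 / 2 * B < \<epsilon>"
    using \<open>\<epsilon> > 0\<close> by (intro order_tendstoD(2)[where f = "\<lambda>t. t * norm d + t\<^sup>2 / 2 * B"]) auto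
  have "\<forall>\<^sub>F t in at_right 0. 0 < t \<and> (\<forall>u\<in>U. f (?x t u) < f xs) \<and>
      (\<forall>j\<in>I. \<forall>u\<in>U. g j (?x t u) < 0) \<and> (\<forall>i\<in>E. \<forall>u\<in>U.
      \<bar>h i (?x t u) - t\<^sup>2 / 2 * (gradient (h i) xs \<bullet> u + curvature (h i) d)\<bar> \<le> e * t\<^sup>2) \<and>
      t * norm d + t\<^sup>2 / 2 * B < \<epsilon>"
    using eventually_at_right_less[of "0::real"] 1 2 3 4 by eventually_elim blast
  then obtain t :: real where t: "0 < t" and tf: "\<And>u. u \<in> U \<Longrightarrow> f (?x t u) < f xs"
    and tg: "\<And>j u. j \<in> I \<Longrightarrow> u \<in> U \<Longrightarrow> g j (?x t u) < 0"
    and th: "\<And>i u. i \<in> E \<Longrightarrow> u \<in> U \<Longrightarrow>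
      \<bar>h i (?x t u) - t\<^sup>2 / 2 * (gradient (h i) xs \<bullet> u + curvature (h i) d)\<bar> \<le> e * t\<^sup>2"
    and tB: "t * norm d + t\<^sup>2 / 2 * B < \<epsilon>"
    using eventually_happens'[OF trivial_limit_at_right_real] by blast
  \<comment> \<open>The rescaled equality constraints are uniformly close to the identity in \<open>y\<close>,
    so Brouwer's theorem yields a common zero.\<close>
  define \<Psi> where "\<Psi> y = (\<chi> i. if i \<in> E then 2 / t\<^sup>2 * h i (?x t (w + G y)) else y $ i)" for y
  have "\<exists>y\<in>cball 0 \<delta>. \<Psi> y = 0"
  proof (rule brouwer_surjective_cball[OF _ \<open>\<delta> > 0\<close>, where S = "{0}"])
    have conth: "continuous_on X (h i)" if "i \<in> E" for i X
      using smooth_h[OF that] unfolding twice_continuously_differentiable_def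
      by (meson continuous_at_imp_continuous_on differentiable_imp_continuous_within)
    show "continuous_on (cball 0 \<delta>) \<Psi>"
      unfolding \<Psi>_def
    proof (rule continuous_on_vec_lambda)
      fix i
      show "continuous_on (cball 0 \<delta>) (\<lambda>y. if i \<in> E then 2 / t\<^sup>2 * h i (?x t (w + G y)) else y $ i)"
      proof (cases "i \<in> E")
        case True
        have "continuous_on (cball 0 \<delta>) (\<lambda>y. h i (?x t (w + G y)))"
          by (rule continuous_on_compose2[OF conth[OF True, of UNIV]])
            (auto intro!: continuous_intros contG)
        then show ?thesis using True t by (auto intro!: continuous_intros)
      qed (auto intro!: continuous_intros)
    qed
    \<comment> \<open>Subtracting \<open>\<Psi> y\<close> from \<open>y\<close> maps the ball into
      itself, and a fixed point of this map is a zero of \<open>\<Psi>\<close>.\<close>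
    fix x y :: "real ^ 'p" assume "x \<in> {0}" and y: "y \<in> cball 0 \<delta>"
    have "norm (y - \<Psi> y) \<le> (\<Sum>i\<in>UNIV. \<bar>(y - \<Psi> y) $ i\<bar>)"
      by (rule norm_le_l1_cart)
    also have "\<dots> \<le> (\<Sum>i\<in>(UNIV :: 'p set). 2 * e)"
    proof (rule sum_mono)
      fix i :: 'p
      show "\<bar>(y - \<Psi> y) $ i\<bar> \<le> 2 * e"
      proof (cases "i \<in> E")
        case True
        have "gradient (h i) xs \<bullet> (w + G y) + curvature (h i) d = y $ i"
          using wh[OF True] hG[OF True] by (simp add: inner_add_right)
        then have *: "\<bar>h i (?x t (w + G y)) - t\<^sup>2 / 2 * y $ i\<bar> \<le> e * t\<^sup>2"
          using th[OF True, of "w + G y"] y by (simp add: U_def)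
        have "(y - \<Psi> y) $ i = - (2 / t\<^sup>2) * (h i (?x t (w + G y)) - t\<^sup>2 / 2 * y $ i)"
          using True t by (simp add: \<Psi>_def field_simps)
        then have "\<bar>(y - \<Psi> y) $ i\<bar> = 2 / t\<^sup>2 * \<bar>h i (?x t (w + G y)) - t\<^sup>2 / 2 * y $ i\<bar>"
          by (simp only: abs_mult abs_minus_cancel) simp
        also have "\<dots> \<le> 2 / t\<^sup>2 * (e * t\<^sup>2)" using * by (intro mult_left_mono) auto
        finally show ?thesis using t by simp
      qed (use \<open>e > 0\<close> in \<open>simp add: \<Psi>_def\<close>)
    qed
    also have "\<dots> = \<delta>" by (simp add: e_def)
    finally show "x + (y - \<Psi> y) \<in> cball 0 \<delta>"
      using \<open>x \<in> {0}\<close> by (simp add: dist_norm norm_minus_commute)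
  qed simp
  then obtain y where y: "y \<in> cball 0 \<delta>" and "\<Psi> y = 0" by blast
  define u where "u = w + G y"
  have "u \<in> U" using y by (auto simp: U_def u_def)
  have "h i (?x t u) = 0" if "i \<in> E" for i
    using \<open>\<Psi> y = 0\<close> that t by (auto simp: \<Psi>_def u_def vec_eq_iff dest!: spec[of _ i])
  then have "feasible E h I g (?x t u)"
    using tg[OF _ \<open>u \<in> U\<close>] by (auto simp: feasible_def intro: less_imp_le)
  moreover have "?x t u \<in> ball xs \<epsilon>"
  proof -
    have "dist (?x t u) xs = norm (t *\<^sub>R d + (t\<^sup>2 / 2) *\<^sub>R u)"
      by (simp add: dist_norm add.assoc)
    also have "\<dots> \<le> t * norm d + t\<^sup>2 / 2 * norm u"
      using norm_triangle_ineq[of "t *\<^sub>R d" "(t\<^sup>2 / 2) *\<^sub>R u"] t by simp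
    also have "\<dots> \<le> t * norm d + t\<^sup>2 / 2 * B"
      using B[OF \<open>u \<in> U\<close>] by (intro add_left_mono mult_left_mono) auto
    finally show ?thesis using tB by (simp add: dist_commute)
  qed
  ultimately show False using \<epsilon> tf[OF \<open>u \<in> U\<close>] by fastforce
qed

lemma curvature_lagrangian:
  assumes "(lam, mu) \<in> multiplier_set f E h I g xs"
  shows "curvature (lagrangian f E h I g lam mu) d
    = curvature f d + (\<Sum>i\<in>E. lam $ i * curvature (h i) d) + (\<Sum>j\<in>A. mu $ j * curvature (g j) d)"
proof -
  have "(\<Sum>j\<in>I. mu $ j * curvature (g j) d) = (\<Sum>j\<in>A. mu $ j * curvature (g j) d)"
    by (rule sum.mono_neutral_right) (use assms in \<open>auto simp: multiplier_set_iff active_set_def\<close>)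
  then show ?thesis
    unfolding hessian_lagrangian
    by (simp add: matrix_vector_mult_add_rdistrib sum_matrix_vector_mult inner_add_right inner_sum_right)
qed

section \<open>Multipliers for a single critical direction\<close>

text \<open>Absence of descent says that 0 avoids a convex set of second-order values; the normal of
  a separating hyperplane is the multiplier, where \<open>l0\<close> may still be 0.\<close>

lemma fritz_john_second_order:
  assumes d: "d \<in> critical_cone f E h I g xs"
  obtains l0 :: real and lam :: "real ^ 'p" and mu :: "real ^ 'q" where "(l0, lam, mu) \<noteq> 0" "0 \<le> l0"
    "\<And>i. i \<notin> E \<Longrightarrow> lam $ i = 0" "\<And>j. j \<notin> A \<Longrightarrow> mu $ j = 0" "\<And>j. 0 \<le> mu $ j"
    "l0 *\<^sub>R gradient f xs + (\<Sum>i\<in>E. lam $ i *\<^sub>R gradient (h i) xs) + (\<Sum>j\<in>A. mu $ j *\<^sub>R gradient (g j) xs) = 0"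
    "0 \<le> l0 * curvature f d + (\<Sum>i\<in>E. lam $ i * curvature (h i) d) + (\<Sum>j\<in>A. mu $ j * curvature (g j) d)"
proof -
  define J where "J = {j \<in> A. gradient (g j) xs \<bullet> d = 0}"
  define p where "p F w = gradient F xs \<bullet> w + curvature F d" for F w
  have p_comb: "p F (u *\<^sub>R w + v *\<^sub>R w') = u * p F w + v * p F w'" if "u + v = 1" for F u v w w'
    using that unfolding p_def
    by (simp add: inner_add_right distrib_left add_ac flip: distrib_right)
  \<comment> \<open>The objective and \<open>J\<close> coordinates strictly exceed attained values
    and the \<open>E\<close> coordinates equal them. All other coordinates are free, which forces
    the matching entries of the normal to vanish.\<close>
  define Z where "Z = {z :: real \<times> (real ^ 'p) \<times> (real ^ 'q). \<exists>w. p f w < fst z \<and>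
      (\<forall>i\<in>E. fst (snd z) $ i = p (h i) w) \<and> (\<forall>j\<in>J. p (g j) w < snd (snd z) $ j)}"
  have "convex Z"
  proof (rule convexI)
    fix z z' and u v :: real
    assume z: "z \<in> Z" and z': "z' \<in> Z" and uv: "0 \<le> u" "0 \<le> v" "u + v = 1"
    have strict: "u * a + v * a' < u * b + v * b'" if "a < b" "a' < b'" for a a' b b' :: real
    proof (cases "u = 0")
      case False
      then have "u * a < u * b" "v * a' \<le> v * b'" using uv that by (auto intro: mult_left_mono)
      then show ?thesis by linarith
    qed (use uv that in auto)
    obtain w where w: "p f w < fst z" "\<forall>i\<in>E. fst (snd z) $ i = p (h i) w"
      "\<forall>j\<in>J. p (g j) w < snd (snd z) $ j" using z by (auto simp: Z_def)
    obtain w' where w': "p f w' < fst z'" "\<forall>i\<in>E. fst (snd z') $ i = p (h i) w'"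
      "\<forall>j\<in>J. p (g j) w' < snd (snd z') $ j" using z' by (auto simp: Z_def)
    show "u *\<^sub>R z + v *\<^sub>R z' \<in> Z"
      unfolding Z_def mem_Collect_eq
      by (rule exI[of _ "u *\<^sub>R w + v *\<^sub>R w'"])
        (use w w' in \<open>auto simp: p_comb[OF uv(3)] intro: strict\<close>)
  qed
  have "0 \<notin> Z"
  proof
    assume "0 \<in> Z"
    then obtain w where "p f w < 0" "\<forall>i\<in>E. p (h i) w = 0" "\<forall>j\<in>J. p (g j) w < 0"
      unfolding Z_def by auto
    then show False
      using no_second_order_descent[OF d] unfolding p_def J_def by blast
  qed
  then obtain a where "a \<noteq> 0" and a: "\<And>z. z \<in> Z \<Longrightarrow> 0 \<le> a \<bullet> z"
    using separating_hyperplane_set_0[OF \<open>convex Z\<close>] by blast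
  obtain l0 lam mu where a_eq: "a = (l0, lam, mu)" by (cases a) auto
  define z where "z w r = (p f w + r, (\<chi> i. p (h i) w), (\<chi> j. p (g j) w + r))" for w r
  have zZ: "z w r \<in> Z" if "r > 0" for w r
    unfolding Z_def z_def mem_Collect_eq by (rule exI[of _ w]) (use that in simp)
  \<comment> \<open>These \<open>e\<close> are recession directions of \<open>Z\<close>, on which a
    functional nonnegative on \<open>Z\<close> is nonnegative. Unit vectors then give the signs and
    zeros of the multipliers.\<close>
  have rec: "0 \<le> a \<bullet> e" if e: "0 \<le> fst e" "\<And>i. i \<in> E \<Longrightarrow> fst (snd e) $ i = 0" "\<And>j. j \<in> J \<Longrightarrow> 0 \<le> snd (snd e) $ j" for e
  proof (rule nonneg_of_scaled_bound)
    fix k :: real assume "k > 0"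
    have "z 0 1 + k *\<^sub>R e \<in> Z"
      unfolding Z_def mem_Collect_eq
      by (rule exI[of _ 0])
        (use e \<open>k > 0\<close> in \<open>auto simp: z_def intro!: add_pos_nonneg less_add_same_cancel1[THEN iffD2]\<close>)
    then show "- (a \<bullet> z 0 1) \<le> k * (a \<bullet> e)"
      using a by (fastforce simp: inner_add_right)
  qed
  have axis_nth: "axis k c $ i = (if i = k then c else 0)" for k i and c :: real
    by (simp add: axis_def)
  have l0: "0 \<le> l0" using rec[of "(1, 0, 0)"] by (simp add: a_eq)
  have lam: "lam $ i = 0" if "i \<notin> E" for i
  proof -
    have "0 \<le> a \<bullet> (0, axis i 1, 0)" "0 \<le> a \<bullet> (0, axis i (- 1), 0)"
      using that by (intro rec; auto simp: axis_nth)+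
    then show ?thesis by (simp add: a_eq inner_axis)
  qed
  have mu: "0 \<le> mu $ j" for j
    using rec[of "(0, 0, axis j 1)"] by (auto simp: a_eq inner_axis axis_nth)
  have muJ: "mu $ j = 0" if "j \<notin> J" for j
  proof -
    have "0 \<le> a \<bullet> (0, 0, axis j (- 1))"
      using that by (intro rec) (auto simp: axis_nth)
    then show ?thesis using mu[of j] by (simp add: a_eq inner_axis)
  qed
  have muA: "mu $ j = 0" if "j \<notin> A" for j using muJ that by (auto simp: J_def)
  define v where "v = l0 *\<^sub>R gradient f xs + (\<Sum>i\<in>E. lam $ i *\<^sub>R gradient (h i) xs) + (\<Sum>j\<in>A. mu $ j *\<^sub>R gradient (g j) xs)"
  define \<kappa> where "\<kappa> = l0 * curvature f d + (\<Sum>i\<in>E. lam $ i * curvature (h i) d) + (\<Sum>j\<in>A. mu $ j * curvature (g j) d)"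
  have az: "a \<bullet> z w r = v \<bullet> w + \<kappa> + r * (l0 + (\<Sum>j\<in>A. mu $ j))" for w r
  proof -
    have "lam \<bullet> (\<chi> i. p (h i) w) = (\<Sum>i\<in>E. lam $ i * p (h i) w)"
      unfolding inner_vec_def inner_real_def vec_lambda_beta
      by (rule sum.mono_neutral_right) (use lam in auto)
    moreover have "mu \<bullet> (\<chi> j. p (g j) w + r) = (\<Sum>j\<in>A. mu $ j * (p (g j) w + r))"
      unfolding inner_vec_def inner_real_def vec_lambda_beta
      by (rule sum.mono_neutral_right) (use muA in auto)
    ultimately show ?thesis
      by (simp add: a_eq z_def v_def \<kappa>_def p_def inner_add_left inner_sum_left
          distrib_left sum.distrib sum_distrib_left add_ac mult.commute[of r])
  qed
  have vk: "0 \<le> v \<bullet> w + \<kappa>" for w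
  proof (rule tendsto_lowerbound)
    have "((\<lambda>r. v \<bullet> w + \<kappa> + r * (l0 + (\<Sum>j\<in>A. mu $ j))) \<longlongrightarrow> v \<bullet> w + \<kappa> + 0 * (l0 + (\<Sum>j\<in>A. mu $ j))) (at_right 0)"
      by (intro tendsto_intros)
    then show "((\<lambda>r. a \<bullet> z w r) \<longlongrightarrow> v \<bullet> w + \<kappa>) (at_right 0)" by (simp add: az)
    show "\<forall>\<^sub>F r in at_right 0. 0 \<le> a \<bullet> z w r"
      using eventually_at_right_less[of "0::real"] by eventually_elim (use a zZ in blast)
  qed simp
  \<comment> \<open>The affine function \<open>v \<bullet> w + \<kappa>\<close> is nonnegative for
    every \<open>w\<close>, so its linear part vanishes.\<close>
  have "0 \<le> v \<bullet> (- v)"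
    by (rule nonneg_of_scaled_bound[of "- \<kappa>"]) (use vk[of "_ *\<^sub>R (- v)"] in \<open>simp add: algebra_simps\<close>)
  then have "v = 0" by (metis inner_gt_zero_iff inner_minus_right neg_0_le_iff_le not_le)
  moreover have "0 \<le> \<kappa>" using vk[of 0] by simp
  moreover have "(l0, lam, mu) \<noteq> 0" using \<open>a \<noteq> 0\<close> a_eq by simp
  ultimately show ?thesis using that l0 lam muA mu unfolding v_def \<kappa>_def by blast
qed

text \<open>With \<open>l0 = 0\<close> the stationarity equation would have only the trivial
  solution by MFCQ; so \<open>l0\<close> is positive and can be normalized to 1.\<close>

lemma second_order_necessary:
  assumes d: "d \<in> critical_cone f E h I g xs"
  shows "\<exists>(lam, mu)\<in>multiplier_set f E h I g xs. 0 \<le> curvature (lagrangian f E h I g lam mu) d"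
proof -
  obtain l0 :: real and lam :: "real ^ 'p" and mu :: "real ^ 'q" where
    nz: "(l0, lam, mu) \<noteq> 0" and l0: "0 \<le> l0" and lam: "\<And>i. i \<notin> E \<Longrightarrow> lam $ i = 0"
    and mu: "\<And>j. j \<notin> A \<Longrightarrow> mu $ j = 0" "\<And>j. 0 \<le> mu $ j"
    and grad: "l0 *\<^sub>R gradient f xs + (\<Sum>i\<in>E. lam $ i *\<^sub>R gradient (h i) xs) + (\<Sum>j\<in>A. mu $ j *\<^sub>R gradient (g j) xs) = 0"
    and curv: "0 \<le> l0 * curvature f d + (\<Sum>i\<in>E. lam $ i * curvature (h i) d) + (\<Sum>j\<in>A. mu $ j * curvature (g j) d)"
    using fritz_john_second_order[OF d] by blast
  have "l0 \<noteq> 0"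
  proof
    assume "l0 = 0"
    with grad have zero: "(\<Sum>i\<in>E. lam $ i *\<^sub>R gradient (h i) xs) + (\<Sum>j\<in>A. mu $ j *\<^sub>R gradient (g j) xs) = 0"
      by simp
    have "lam $ i = 0" for i using mfcqD(1)[OF zero mu(2)] lam by blast
    moreover have "mu $ j = 0" for j using mfcqD(2)[OF zero mu(2)] mu(1) by blast
    ultimately show False using nz \<open>l0 = 0\<close> by (simp add: vec_eq_iff zero_prod_def)
  qed
  then have "l0 > 0" using l0 by simp
  define lam' mu' where "lam' = (1 / l0) *\<^sub>R lam" and "mu' = (1 / l0) *\<^sub>R mu"
  have "(1 / l0) *\<^sub>R (l0 *\<^sub>R gradient f xs + (\<Sum>i\<in>E. lam $ i *\<^sub>R gradient (h i) xs)
      + (\<Sum>j\<in>A. mu $ j *\<^sub>R gradient (g j) xs)) = 0"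
    unfolding grad by simp
  then have "gradient f xs + (\<Sum>i\<in>E. lam' $ i *\<^sub>R gradient (h i) xs) + (\<Sum>j\<in>A. mu' $ j *\<^sub>R gradient (g j) xs) = 0"
    using \<open>l0 \<noteq> 0\<close> by (simp add: lam'_def mu'_def scaleR_add_right scaleR_sum_right)
  then have mem: "(lam', mu') \<in> multiplier_set f E h I g xs"
    unfolding multiplier_set_iff using lam mu l0 by (simp add: lam'_def mu'_def)
  have "0 \<le> (1 / l0) * (l0 * curvature f d + (\<Sum>i\<in>E. lam $ i * curvature (h i) d)
      + (\<Sum>j\<in>A. mu $ j * curvature (g j) d))"
    using curv l0 by (intro mult_nonneg_nonneg) auto
  also have "\<dots> = curvature (lagrangian f E h I g lam' mu') d"
    unfolding curvature_lagrangian[OF mem] using \<open>l0 \<noteq> 0\<close>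
    by (simp add: lam'_def mu'_def distrib_left sum_divide_distrib add_divide_distrib)
  finally show ?thesis using mem by blast
qed

section \<open>Convexity and compactness of the multiplier set\<close>

lemma convex_multiplier_set: "convex (multiplier_set f E h I g xs)"
proof (rule convexI)
  fix z z' and u v :: real
  assume z: "z \<in> multiplier_set f E h I g xs" and z': "z' \<in> multiplier_set f E h I g xs"
    and uv: "0 \<le> u" "0 \<le> v" "u + v = 1"
  let ?v = "\<lambda>lam mu. (\<Sum>i\<in>E. lam $ i *\<^sub>R gradient (h i) xs) + (\<Sum>j\<in>A. mu $ j *\<^sub>R gradient (g j) xs)"
  obtain lam mu lam' mu' where eq: "z = (lam, mu)" "z' = (lam', mu')" by (cases z, cases z')
  have "gradient f xs + ?v (u *\<^sub>R lam + v *\<^sub>R lam') (u *\<^sub>R mu + v *\<^sub>R mu')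
      = (u + v) *\<^sub>R gradient f xs + ?v (u *\<^sub>R lam + v *\<^sub>R lam') (u *\<^sub>R mu + v *\<^sub>R mu')"
    using uv by simp
  also have "\<dots> = u *\<^sub>R (gradient f xs + ?v lam mu) + v *\<^sub>R (gradient f xs + ?v lam' mu')"
    by (simp add: scaleR_add_left scaleR_add_right sum.distrib scaleR_sum_right add_ac)
  also have "\<dots> = 0" using z z' by (simp add: eq multiplier_set_iff add.assoc)
  finally show "u *\<^sub>R z + v *\<^sub>R z' \<in> multiplier_set f E h I g xs"
    using z z' uv by (simp add: eq multiplier_set_iff add.assoc)
qed

text \<open>By MFCQ the linear map \<open>?v\<close> has no nonzero root in the cone
  \<open>R\<close>, so its norm has a positive minimum on the unit vectors of \<open>R\<close>. By
  homogeneity \<open>?v z = - gradient f xs\<close> then bounds \<open>norm z\<close>.\<close>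

lemma compact_multiplier_set: "compact (multiplier_set f E h I g xs)"
proof -
  let ?v = "\<lambda>z :: (real ^ 'p) \<times> (real ^ 'q). (\<Sum>i\<in>E. fst z $ i *\<^sub>R gradient (h i) xs) + (\<Sum>j\<in>A. snd z $ j *\<^sub>R gradient (g j) xs)"
  define R where "R = {z :: (real ^ 'p) \<times> (real ^ 'q). (\<forall>i. i \<notin> E \<longrightarrow> fst z $ i = 0) \<and>
      (\<forall>j. j \<notin> A \<longrightarrow> snd z $ j = 0) \<and> (\<forall>j. 0 \<le> snd z $ j)}"
  have eq: "multiplier_set f E h I g xs = R \<inter> {z. gradient f xs + ?v z = 0}"
    by (auto simp: R_def multiplier_set_iff add.assoc)
  have "closed R"
    unfolding R_def
    by (intro closed_Collect_conj closed_Collect_all closed_Collect_imp closed_Collect_eq closed_Collect_le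
        open_Collect_const continuous_intros)
  then have closed: "closed (multiplier_set f E h I g xs)"
    unfolding eq by (intro closed_Int closed_Collect_eq continuous_intros)
  have "bounded (multiplier_set f E h I g xs)"
  proof (cases "R \<inter> sphere 0 1 = {}")
    \<comment> \<open>Here \<open>E\<close> and \<open>A\<close> are both empty and \<open>R\<close>
      is the origin alone; the minimum taken in the other case needs a nonempty set.\<close>
    case True
    have "z = 0" if "z \<in> R" for z
    proof (rule ccontr)
      assume "z \<noteq> 0"
      then have "(1 / norm z) *\<^sub>R z \<in> R \<inter> sphere 0 1" using that by (auto simp: R_def)
      then show False using True by blast
    qed
    then have "multiplier_set f E h I g xs \<subseteq> {0}" unfolding eq by blast
    then show ?thesis by (rule bounded_subset[rotated]) simp
  next
    case False
    have comp: "compact (R \<inter> sphere 0 1)" using \<open>closed R\<close> by (simp add: closed_Int_compact)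
    have cont: "continuous_on (R \<inter> sphere 0 1) (\<lambda>z. norm (?v z))" by (intro continuous_intros)
    have "\<exists>z0\<in>R \<inter> sphere 0 1. \<forall>z\<in>R \<inter> sphere 0 1. norm (?v z0) \<le> norm (?v z)"
      by (rule continuous_attains_inf[OF comp False cont])
    then obtain z0 where z0: "z0 \<in> R \<inter> sphere 0 1"
      and min: "\<forall>z\<in>R \<inter> sphere 0 1. norm (?v z0) \<le> norm (?v z)"
      by (rule bexE)
    have "?v z0 \<noteq> 0"
    proof
      assume zero: "?v z0 = 0"
      have nonneg: "\<And>j. 0 \<le> snd z0 $ j" and supp: "\<And>i. i \<notin> E \<Longrightarrow> fst z0 $ i = 0" "\<And>j. j \<notin> A \<Longrightarrow> snd z0 $ j = 0"
        using z0 by (simp_all add: R_def)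
      have "fst z0 $ i = 0" for i using mfcqD(1)[OF zero nonneg] supp by blast
      moreover have "snd z0 $ j = 0" for j using mfcqD(2)[OF zero nonneg] supp by blast
      ultimately have "z0 = 0" by (simp add: prod_eq_iff vec_eq_iff)
      then show False using z0 by simp
    qed
    have "norm z \<le> norm (gradient f xs) / norm (?v z0)" if z: "z \<in> R" "gradient f xs + ?v z = 0" for z
    proof (cases "z = 0")
      case False
      then have "(1 / norm z) *\<^sub>R z \<in> R \<inter> sphere 0 1" using z by (auto simp: R_def)
      from min[rule_format, OF this] have "norm (?v z0) \<le> norm ((1 / norm z) *\<^sub>R ?v z)"
        by (simp add: scaleR_add_right scaleR_sum_right)
      also have "\<dots> = norm (gradient f xs) / norm z"
        unfolding z(2)[unfolded add_eq_0_iff] by simp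
      finally show ?thesis using False \<open>?v z0 \<noteq> 0\<close> by (simp add: field_simps)
    qed simp
    then show ?thesis unfolding eq bounded_iff by blast
  qed
  then show ?thesis using closed by (simp add: compact_eq_bounded_closed)
qed

section \<open>One multiplier for a whole first-order cone\<close>

lemma second_order_necessary_first_order_cone:
  assumes rank: "dim {hessian (lagrangian f E h I g lam mu) xs | lam mu.
      (lam, mu) extreme_point_of multiplier_set f E h I g xs} \<le> 2" (is "dim ?M \<le> 2")
    and K: "first_order_cone K" "K \<subseteq> critical_cone f E h I g xs"
  shows "\<exists>(lam, mu)\<in>multiplier_set f E h I g xs.
    \<forall>d\<in>K. 0 \<le> curvature (lagrangian f E h I g lam mu) d"
proof -
  let ?\<Lambda> = "multiplier_set f E h I g xs"
  define H where "H = (\<lambda>(lam, mu). hessian (lagrangian f E h I g lam mu) xs)"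
  define L :: "(real ^ 'p) \<times> (real ^ 'q) \<Rightarrow> real ^ 'n ^ 'n" where "L = (\<lambda>(lam, mu). (\<Sum>i\<in>E. lam $ i *\<^sub>R hessian (h i) xs) + (\<Sum>j\<in>I. mu $ j *\<^sub>R hessian (g j) xs))"
  have H: "H z = hessian f xs + L z" for z
    by (cases z) (simp add: H_def L_def hessian_lagrangian)
  then have HL: "H ` X = (+) (hessian f xs) ` L ` X" for X by (auto simp: image_image)
  have "linear L"
    unfolding L_def by (intro linearI) (auto simp: scaleR_add_left sum.distrib scaleR_add_right scaleR_sum_right)
  \<comment> \<open>\<open>H\<close> is affine, so it commutes with convex hulls, and the compact
    convex set \<open>?\<Lambda>\<close> is the hull of its vertices. Every Hessian over
    \<open>?\<Lambda>\<close> thus lies in the span of those at the vertices.\<close>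
  have "H ` ?\<Lambda> = H ` (convex hull {z. z extreme_point_of ?\<Lambda>})"
    using Krein_Milman_Minkowski[OF compact_multiplier_set convex_multiplier_set] by simp
  also have "\<dots> = convex hull (H ` {z. z extreme_point_of ?\<Lambda>})"
    unfolding HL by (simp add: convex_hull_linear_image[OF \<open>linear L\<close>] convex_hull_translation)
  also have "H ` {z. z extreme_point_of ?\<Lambda>} = ?M"
    by (auto simp: H_def)
  finally have span: "H ` ?\<Lambda> \<subseteq> span ?M" using convex_hull_subset_span by blast
  have compact: "compact (H ` ?\<Lambda>)"
    unfolding HL using \<open>linear L\<close> compact_multiplier_set
    by (intro compact_translation compact_continuous_image linear_continuous_on)
      (simp_all add: linear_conv_bounded_linear)
  have convex: "convex (H ` ?\<Lambda>)"
    unfolding HL by (intro convex_translation convex_linear_image[OF \<open>linear L\<close>] convex_multiplier_set)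
  obtain S d0 where S: "subspace S" and K_eq: "K = {s + t *\<^sub>R d0 | s t. s \<in> S \<and> t \<ge> 0}"
    using K by (auto simp: first_order_cone_def)
  \<comment> \<open>Quadratic forms are even, so \<open>K\<close> may be replaced by the subspace \<open>K \<union> - K\<close>.\<close>
  define V where "V = {s + t *\<^sub>R d0 | s t. s \<in> S}"
  have "subspace V"
  proof -
    have "V = {x + y | x y. x \<in> S \<and> y \<in> span {d0}}" by (auto simp: V_def span_singleton)
    then show ?thesis using subspace_sums[OF S subspace_span] by simp
  qed
  have nonneg: "\<exists>B\<in>H ` ?\<Lambda>. 0 \<le> d \<bullet> (B *v d)" if "d \<in> V" for d
  proof -
    have "d \<in> K \<or> - d \<in> K"
    proof -
      obtain s t where d: "d = s + t *\<^sub>R d0" "s \<in> S" using \<open>d \<in> V\<close> by (auto simp: V_def)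
      have "- d = - s + (- t) *\<^sub>R d0" "- s \<in> S" using d S by (auto simp: subspace_neg)
      then show ?thesis unfolding K_eq using d by (cases "t \<ge> 0") (blast, smt (verit) mem_Collect_eq)
    qed
    then obtain d' where "d' = d \<or> d' = - d" "d' \<in> K" by blast
    then obtain z where z: "z \<in> ?\<Lambda>" "0 \<le> d' \<bullet> (H z *v d')"
      using second_order_necessary[of d'] K(2) unfolding H_def by fast
    have "0 \<le> d \<bullet> (H z *v d)"
      using z(2) \<open>d' = d \<or> d' = - d\<close> by (auto simp: linear_neg[OF matrix_vector_mul_linear])
    then show ?thesis using z(1) by blast
  qed
  obtain B where B: "B \<in> H ` ?\<Lambda>" and BV: "\<forall>d\<in>V. 0 \<le> d \<bullet> (B *v d)"
    using psd_on_subspace_of_rank_2[OF compact convex span rank \<open>subspace V\<close> nonneg] by (rule bexE)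
  obtain lam mu where z: "(lam, mu) \<in> ?\<Lambda>" and "B = H (lam, mu)"
    using B by (elim imageE) (metis surj_pair)
  moreover have "K \<subseteq> V" unfolding K_eq V_def by blast
  ultimately have "\<forall>d\<in>K. 0 \<le> curvature (lagrangian f E h I g lam mu) d"
    using BV by (auto simp: H_def)
  then show ?thesis using z by (intro bexI[of _ "(lam, mu)"]) simp_all
qed

end

theorem theorem2:
  fixes f :: "real ^ 'n \<Rightarrow> real"
    and h :: "'p::finite \<Rightarrow> real ^ 'n \<Rightarrow> real" and E :: "'p set"
    and g :: "'q::finite \<Rightarrow> real ^ 'n \<Rightarrow> real" and I :: "'q set"
    and xs :: "real ^ 'n"
  assumes "twice_continuously_differentiable f"
    and "\<And>i. i \<in> E \<Longrightarrow> twice_continuously_differentiable (h i)"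
    and "\<And>j. j \<in> I \<Longrightarrow> twice_continuously_differentiable (g j)"
    and "local_minimizer f E h I g xs"
    and "MFCQ E h I g xs"
    and "matrix_set_rank
           {hessian (lagrangian f E h I g lam mu) xs | lam mu.
              (lam, mu) extreme_point_of multiplier_set f E h I g xs} \<le> 2"
  shows "\<forall>K. first_order_cone K \<and> K \<subseteq> critical_cone f E h I g xs \<longrightarrow>
           (\<exists>(lam, mu) \<in> multiplier_set f E h I g xs.
              \<forall>d\<in>K. d \<bullet> (hessian (lagrangian f E h I g lam mu) xs *v d) \<ge> 0)"
proof -
  interpret nlp_minimizer f h E g I xs
    by unfold_locales (fact assms)+
  show ?thesis
    using second_order_necessary_first_order_cone[OF assms(6)[unfolded matrix_set_rank_eq_dim]]
    by simp
qed

end
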